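(* Let $G$ be a finitely generated group with finitely generated subgroups $H_1,\ldots,H_n$. For $i=1,\ldots,n$, let $X_i$ be a nontrivial $H_i$-almost invariant subset of $G$, and suppose that, for distinct $i$ and $j$, the $G$-orbits of $X_i$ and $X_j$ are not parallel. Suppose that $X_i$ is equivalent to $Y_i$ and to $Z_i$ (almost invariant subsets of $G$) such that the $Y_i$'s are in good position and the $Z_i$'s are in good position. Further suppose that, for each $i$, $Y_i$ and $Z_i$ are not invertible. Then there is a $G$-equivariant bijection $\varphi:E(Y_1,\ldots,Y_n)\rightarrow E(Z_1,\ldots,Z_n)$ which preserves the partial order $\leq$ and preserves equivalence classes.
   Context: For a subgroup $H$ of $G$, $H\backslash G$ is the set of cosets $Hg$, on which $G$ acts on the right. Two sets are almost equal if their symmetric difference is finite. A subset $P$ of a set with right $G$-action is almost invariant if $Pg$ is almost equal to $P$ for all $g\in G$. A subset $X\subset G$ is $H$-almost invariant if $hX=X$ for all $h\in H$ and $H\backslash X$ is an almost invariant subset of $H\backslash G$; it is nontrivial if $H\backslash X$ and $H\backslash X^{\ast}$ are both infinite, where $X^{\ast}=G-X$. A subset of $G$ is $H$-finite if it is contained in a finite union of cosets $Hg$. If $X$ is $H$-almost invariant then $gX$ is $gHg^{-1}$-almost invariant. An $H$-almost invariant set $X$ and a $K$-almost invariant set $Y$ are equivalent, $X\sim Y$, if their symmetric difference is $H$-finite. $X$ is invertible if $gX=X^{\ast}$ for some $g\in G$. The $G$-orbits of $X_i$ and $X_j$ are parallel if some translate of $X_i$ is equivalent to $X_j$ or $X_j^{\ast}$.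 For almost invariant subsets $Y_1,\ldots,Y_n$ of $G$, let $E(Y_1,\ldots,Y_n)=\{gY_i,gY_i^{\ast}:g\in G,1\leq i\leq n\}$. The corners of a pair $(U,V)$ of subsets of $G$ are $U\cap V$, $U^{\ast}\cap V$, $U\cap V^{\ast}$, $U^{\ast}\cap V^{\ast}$. If $U$ is nontrivial $H$-almost invariant and $V$ is nontrivial $K$-almost invariant, a corner is small if it is $H$-finite (equivalently $K$-finite). The family $Y_1,\ldots,Y_n$ is in good position if, whenever $U,V\in E(Y_1,\ldots,Y_n)$ and two of the four corners of $(U,V)$ are small, one of the four corners is empty. In that case a partial order $\leq$ on $E(Y_1,\ldots,Y_n)$ is defined by: $U\leq V$ if and only if $U\cap V^{\ast}$ is empty or is the only small set among the four corners of $(U,V)$. A map $\varphi$ preserves $\leq$ if $U\leq V$ implies $\varphi(U)\leq\varphi(V)$, and preserves equivalence classes if $\varphi(U)\sim U$ for every $U$. *)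

theory Defs
  imports "HOL-Algebra.Generated_Groups"
begin

definition fin_gen :: "('a, 'b) monoid_scheme \<Rightarrow> 'a set \<Rightarrow> bool" where
  "fin_gen G H \<longleftrightarrow> (\<exists>S. finite S \<and> S \<subseteq> carrier G \<and> H = generate G S)"

definition almost_equal :: "'p set \<Rightarrow> 'p set \<Rightarrow> bool" where
  "almost_equal P Q \<longleftrightarrow> finite (sym_diff P Q)"

text \<open>Here \<open>act p g\<close> is the image of the point \<open>p\<close> under the right action of \<open>g\<close>.\<close>

definition almost_invariant ::
    "('a, 'b) monoid_scheme \<Rightarrow> ('p \<Rightarrow> 'a \<Rightarrow> 'p) \<Rightarrow> 'p set \<Rightarrow> bool" where
  "almost_invariant G act P \<longleftrightarrow> (\<forall>g\<in>carrier G. almost_equal ((\<lambda>p. act p g) ` P) P)"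

definition coset_image :: "('a, 'b) monoid_scheme \<Rightarrow> 'a set \<Rightarrow> 'a set \<Rightarrow> 'a set set" where
  "coset_image G H X = (\<lambda>x. H #>\<^bsub>G\<^esub> x) ` X"

definition ai_over :: "('a, 'b) monoid_scheme \<Rightarrow> 'a set \<Rightarrow> 'a set \<Rightarrow> bool" where
  "ai_over G H X \<longleftrightarrow>
     subgroup H G \<and> X \<subseteq> carrier G \<and> (\<forall>h\<in>H. h <#\<^bsub>G\<^esub> X = X) \<and>
     almost_invariant G (\<lambda>C g. C #>\<^bsub>G\<^esub> g) (coset_image G H X)"

definition star_compl :: "('a, 'b) monoid_scheme \<Rightarrow> 'a set \<Rightarrow> 'a set" where
  "star_compl G X = carrier G - X"

definition nontrivial_ai_over :: "('a, 'b) monoid_scheme \<Rightarrow> 'a set \<Rightarrow> 'a set \<Rightarrow> bool" where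
  "nontrivial_ai_over G H X \<longleftrightarrow>
     ai_over G H X \<and> infinite (coset_image G H X) \<and> infinite (coset_image G H (star_compl G X))"

definition H_finite :: "('a, 'b) monoid_scheme \<Rightarrow> 'a set \<Rightarrow> 'a set \<Rightarrow> bool" where
  "H_finite G H A \<longleftrightarrow>
     (\<exists>F. finite F \<and> F \<subseteq> carrier G \<and> A \<subseteq> (\<Union>g\<in>F. H #>\<^bsub>G\<^esub> g))"

definition conj_subgroup :: "('a, 'b) monoid_scheme \<Rightarrow> 'a \<Rightarrow> 'a set \<Rightarrow> 'a set" where
  "conj_subgroup G g H = (g <#\<^bsub>G\<^esub> H) #>\<^bsub>G\<^esub> (inv\<^bsub>G\<^esub> g)"

definition ai_equiv_over ::
    "('a, 'b) monoid_scheme \<Rightarrow> 'a set \<Rightarrow> 'a set \<Rightarrow> 'a set \<Rightarrow> 'a set \<Rightarrow> bool" where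
  "ai_equiv_over G H X K Y \<longleftrightarrow>
     ai_over G H X \<and> ai_over G K Y \<and> H_finite G H (sym_diff X Y)"

text \<open>
  The same relation for sets whose subgroups are not named, as for the members of \<open>E_set\<close>.
  If \<open>G\<close> is finitely generated and \<open>X\<close> is neither empty nor all of \<open>carrier G\<close>, then any two
  subgroups over which \<open>X\<close> is almost invariant are commensurable, so the choice of the
  witnesses does not matter. The same remark applies to \<open>small_corner\<close> below.
\<close>

definition ai_equiv :: "('a, 'b) monoid_scheme \<Rightarrow> 'a set \<Rightarrow> 'a set \<Rightarrow> bool" where
  "ai_equiv G X Y \<longleftrightarrow> (\<exists>H K. ai_equiv_over G H X K Y)"

definition invertible_ai :: "('a, 'b) monoid_scheme \<Rightarrow> 'a set \<Rightarrow> bool" where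
  "invertible_ai G X \<longleftrightarrow> (\<exists>g\<in>carrier G. g <#\<^bsub>G\<^esub> X = star_compl G X)"

definition parallel_orbits ::
    "('a, 'b) monoid_scheme \<Rightarrow> 'a set \<Rightarrow> 'a set \<Rightarrow> 'a set \<Rightarrow> 'a set \<Rightarrow> bool" where
  "parallel_orbits G H X K Y \<longleftrightarrow>
     (\<exists>g\<in>carrier G.
        ai_equiv_over G (conj_subgroup G g H) (g <#\<^bsub>G\<^esub> X) K Y \<or>
        ai_equiv_over G (conj_subgroup G g H) (g <#\<^bsub>G\<^esub> X) K (star_compl G Y))"

definition E_set :: "('a, 'b) monoid_scheme \<Rightarrow> nat \<Rightarrow> (nat \<Rightarrow> 'a set) \<Rightarrow> 'a set set" where
  "E_set G n Y =
     {U. \<exists>g\<in>carrier G. \<exists>i\<in>{1..n}. U = g <#\<^bsub>G\<^esub> Y i \<or> U = star_compl G (g <#\<^bsub>G\<^esub> Y i)}"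

definition corners :: "('a, 'b) monoid_scheme \<Rightarrow> 'a set \<Rightarrow> 'a set \<Rightarrow> 'a set set" where
  "corners G U V =
     {U \<inter> V, star_compl G U \<inter> V, U \<inter> star_compl G V, star_compl G U \<inter> star_compl G V}"

definition small_corner :: "('a, 'b) monoid_scheme \<Rightarrow> 'a set \<Rightarrow> 'a set \<Rightarrow> 'a set \<Rightarrow> bool" where
  "small_corner G U V C \<longleftrightarrow>
     C \<in> corners G U V \<and>
     (\<exists>H K. nontrivial_ai_over G H U \<and> nontrivial_ai_over G K V \<and> H_finite G H C)"

text \<open>
  The four corners are pairwise disjoint, so two of them coincide in the set \<open>corners G U V\<close>
  only if both are empty. Hence counting corners as sets in the next two definitions agrees
  with counting them with their positions: where the counts differ, some corner is empty in
  \<open>good_position\<close>, and in \<open>E_le\<close> the corner \<open>U \<inter> V\<^sup>*\<close>, when nonempty, differs from the other three.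
\<close>

definition good_position :: "('a, 'b) monoid_scheme \<Rightarrow> nat \<Rightarrow> (nat \<Rightarrow> 'a set) \<Rightarrow> bool" where
  "good_position G n Y \<longleftrightarrow>
     (\<forall>U\<in>E_set G n Y. \<forall>V\<in>E_set G n Y.
        (\<exists>C D. C \<noteq> D \<and> small_corner G U V C \<and> small_corner G U V D) \<longrightarrow> {} \<in> corners G U V)"

definition E_le :: "('a, 'b) monoid_scheme \<Rightarrow> 'a set \<Rightarrow> 'a set \<Rightarrow> bool" where
  "E_le G U V \<longleftrightarrow>
     U \<inter> star_compl G V = {} \<or> (\<forall>C. small_corner G U V C \<longleftrightarrow> C = U \<inter> star_compl G V)"

definition G_equivariant_on ::
    "('a, 'b) monoid_scheme \<Rightarrow> 'a set set \<Rightarrow> ('a set \<Rightarrow> 'a set) \<Rightarrow> bool" where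
  "G_equivariant_on G E \<phi> \<longleftrightarrow>
     (\<forall>g\<in>carrier G. \<forall>U\<in>E. \<phi> (g <#\<^bsub>G\<^esub> U) = g <#\<^bsub>G\<^esub> \<phi> U)"

end

theory Submission
  imports Defs
begin

text \<open>
  The obvious candidate \<open>g Y\<^sub>i \<mapsto> g Z\<^sub>i\<close>, \<open>g Y\<^sub>i\<^sup>* \<mapsto> g Z\<^sub>i\<^sup>*\<close> is almost right, and the proof consists in
  seeing how it can fail and correcting it.

  Between inequivalent sets there is nothing to choose. If \<open>U\<close> and \<open>V\<close> are equivalent neither to each
  other nor to each other's complement, at most one of their corners is small, and which one is
  small depends only on the equivalence classes (\<open>small_corner_transfer\<close>). If \<open>U\<close> is equivalent to
  \<open>V\<^sup>*\<close> then \<open>U \<inter> V\<close> and \<open>U\<^sup>* \<inter> V\<^sup>*\<close> are small, and \<open>U \<le> V\<close> never holds. So the order between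
  inequivalent sets is respected by every bijection that preserves equivalence
  (\<open>E_le_transfer\<close>), and only the order inside one equivalence class matters. There the order is
  inclusion, and by good position it is total.

  Inside an equivalence class one can measure. Some positive power of any element stabilising \<open>V\<close> also
  stabilises every \<open>U \<sim> V\<close>. As \<open>U\<close> is nested with its translate, the element itself stabilises \<open>U\<close>.
  Hence all members of \<open>E(Y)\<close> and of \<open>E(Z)\<close> in one class have the same stabiliser \<open>S\<close>
  (\<open>translate_stab_eq\<close>), and
    \<open>d(U, V) = |S\(U - V)| - |S\(V - U)|\<close>
  is an integer that is additive, \<open>G\<close>-invariant, changes sign under complementation, and detects
  inclusion by its sign on nested pairs. Thus \<open>U \<mapsto> d(U, Y\<^sub>i)\<close> puts the members of \<open>E(Y)\<close> and
  \<open>E(Z)\<close> equivalent to \<open>Y\<^sub>i\<close> on one integer line. There, any \<open>g\<close> preserving the class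
  acts by the same translation on both families, so \<open>g Y\<^sub>i \<subseteq> Y\<^sub>i\<close> iff \<open>g Z\<^sub>i \<subseteq> Z\<^sub>i\<close>. Any \<open>a\<close>
  with \<open>a Y\<^sub>i\<^sup>* \<sim> Y\<^sub>i\<close> gives a reflection \<open>x \<mapsto> r - x\<close> of the line, where \<open>r = d(a Y\<^sub>i\<^sup>*, Y\<^sub>i)\<close>.

  The reflections are what can go wrong: \<open>Y\<^sub>i\<close> and \<open>Z\<^sub>i\<close> may lie on different sides of the centre
  \<open>r/2\<close>, and then \<open>Y\<^sub>i \<subseteq> a Y\<^sub>i\<^sup>*\<close> while \<open>a Z\<^sub>i\<^sup>* \<subseteq> Z\<^sub>i\<close>. The remedy is to replace \<open>Z\<^sub>i\<close> by the set
  \<open>Z\<^sub>i'\<close> nearest to \<open>Y\<^sub>i\<close>, with respect to \<open>|d|\<close>, among all \<open>g Z\<^sub>i\<close> and \<open>g Z\<^sub>i\<^sup>*\<close> equivalent to \<open>Y\<^sub>i\<close>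
  (\<open>exists_nearest_translate\<close>). If a centre separated the two, reflecting \<open>Z\<^sub>i'\<close> in it would
  bring it closer. No set lies on a centre, because it would be invertible. This
  does not change \<open>E(Z)\<close>, and \<open>g Y\<^sub>i \<mapsto> g Z\<^sub>i'\<close>, \<open>g Y\<^sub>i\<^sup>* \<mapsto> g Z\<^sub>i'\<^sup>*\<close> preserves inclusion inside
  classes (\<open>corresponds_mono\<close>). Applied to equal sets, monotonicity also shows that the assignment is
  well defined; since the situation is symmetric in the two families, it is injective as well.
\<close>

definition translate_stab :: "('a, 'b) monoid_scheme \<Rightarrow> 'a set \<Rightarrow> 'a set" where
  "translate_stab G U = {g \<in> carrier G. g <#\<^bsub>G\<^esub> U = U}"

text \<open>
  A nontrivial almost invariant set can be treated without naming a subgroup: its full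
  stabiliser under left translation will do, as it defines the same finite sets as any
  other choice (\<open>nontrivial_ai_over_translate_stab\<close> below).
\<close>

definition nontrivial_ai :: "('a, 'b) monoid_scheme \<Rightarrow> 'a set \<Rightarrow> bool" where
  "nontrivial_ai G U \<longleftrightarrow> nontrivial_ai_over G (translate_stab G U) U"

definition ai_sim :: "('a, 'b) monoid_scheme \<Rightarrow> 'a set \<Rightarrow> 'a set \<Rightarrow> bool" where
  "ai_sim G U V \<longleftrightarrow>
     nontrivial_ai G U \<and> nontrivial_ai G V \<and> H_finite G (translate_stab G U) (sym_diff U V)"

context group
begin

section \<open>Translates, complements and H-finite sets\<close>

lemma mem_lcos:
  assumes "g \<in> carrier G" "U \<subseteq> carrier G"
  shows "x \<in> g <# U \<longleftrightarrow> x \<in> carrier G \<and> inv g \<otimes> x \<in> U"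
proof
  assume "x \<in> g <# U"
  then obtain u where "u \<in> U" "x = g \<otimes> u" by (auto simp: l_coset_def)
  then show "x \<in> carrier G \<and> inv g \<otimes> x \<in> U"
    using assms by (auto simp: m_assoc[symmetric] subset_iff)
next
  assume "x \<in> carrier G \<and> inv g \<otimes> x \<in> U"
  moreover from this have "x = g \<otimes> (inv g \<otimes> x)" using assms by (simp add: m_assoc[symmetric])
  ultimately show "x \<in> g <# U" unfolding l_coset_def by blast
qed

lemma mem_rcos:
  assumes "g \<in> carrier G" "U \<subseteq> carrier G"
  shows "x \<in> U #> g \<longleftrightarrow> x \<in> carrier G \<and> x \<otimes> inv g \<in> U"
proof
  assume "x \<in> U #> g"
  then obtain u where "u \<in> U" "x = u \<otimes> g" by (auto simp: r_coset_def)
  then show "x \<in> carrier G \<and> x \<otimes> inv g \<in> U"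
    using assms by (auto simp: m_assoc subset_iff)
next
  assume "x \<in> carrier G \<and> x \<otimes> inv g \<in> U"
  moreover from this have "x = (x \<otimes> inv g) \<otimes> g" using assms by (simp add: m_assoc)
  ultimately show "x \<in> U #> g" unfolding r_coset_def by blast
qed

lemma star_compl_subset: "star_compl G U \<subseteq> carrier G"
  by (auto simp: star_compl_def)

lemma star_compl_star_compl: "U \<subseteq> carrier G \<Longrightarrow> star_compl G (star_compl G U) = U"
  by (auto simp: star_compl_def)

lemma sym_diff_star_compl:
  "\<lbrakk>U \<subseteq> carrier G; V \<subseteq> carrier G\<rbrakk> \<Longrightarrow> sym_diff (star_compl G U) (star_compl G V) = sym_diff U V"
  by (auto simp: star_compl_def)

lemma lcos_star_compl:
  assumes "g \<in> carrier G" "U \<subseteq> carrier G"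
  shows "g <# star_compl G U = star_compl G (g <# U)"
  using assms star_compl_subset by (auto simp: mem_lcos star_compl_def)

lemma lcos_diff:
  assumes "g \<in> carrier G" "A \<subseteq> carrier G" "B \<subseteq> carrier G"
  shows "g <# (A - B) = (g <# A) - (g <# B)"
  using assms by (auto simp: mem_lcos Diff_subset[THEN subset_trans])

lemma lcos_mono: "A \<subseteq> B \<Longrightarrow> g <# A \<subseteq> g <# B"
  by (auto simp: l_coset_def)

lemma lcos_Un: "g <# (A \<union> B) = (g <# A) \<union> (g <# B)"
  by (auto simp: l_coset_def)

lemma lcos_inv_cancel:
  assumes "g \<in> carrier G" "A \<subseteq> carrier G"
  shows "inv g <# (g <# A) = A" "g <# (inv g <# A) = A"
  using assms by (simp_all add: lcos_m_assoc lcos_mult_one)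

lemma lcos_rcos:
  assumes "g \<in> carrier G" "h \<in> carrier G" "A \<subseteq> carrier G"
  shows "h <# (A #> g) = (h <# A) #> g"
  using assms by (auto simp: mem_lcos mem_rcos r_coset_subset_G l_coset_subset_G m_assoc)

lemma rcos_star_compl:
  assumes "g \<in> carrier G" "U \<subseteq> carrier G"
  shows "star_compl G U #> g = star_compl G (U #> g)"
  using assms star_compl_subset by (auto simp: mem_rcos star_compl_def)

lemma H_finite_mono: "\<lbrakk>H_finite G H B; A \<subseteq> B\<rbrakk> \<Longrightarrow> H_finite G H A"
  unfolding H_finite_def by blast

lemma H_finite_empty: "H_finite G H {}"
  unfolding H_finite_def by blast

lemma H_finite_Un:
  assumes "H_finite G H A" "H_finite G H B"
  shows "H_finite G H (A \<union> B)"
proof -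
  obtain E F where "finite E" "E \<subseteq> carrier G" "A \<subseteq> (\<Union>g\<in>E. H #> g)"
    and "finite F" "F \<subseteq> carrier G" "B \<subseteq> (\<Union>g\<in>F. H #> g)"
    using assms unfolding H_finite_def by auto
  then show ?thesis
    unfolding H_finite_def by (intro exI[of _ "E \<union> F"]) auto
qed

lemma H_finite_UN:
  assumes "finite I" "\<And>i. i \<in> I \<Longrightarrow> H_finite G H (A i)"
  shows "H_finite G H (\<Union>i\<in>I. A i)"
  using assms
proof (induction rule: finite_induct)
  case empty
  show ?case by (simp add: H_finite_empty)
next
  case (insert j I)
  then have "H_finite G H (A j \<union> (\<Union>i\<in>I. A i))"
    by (intro H_finite_Un) blast+
  then show ?case by (simp only: UN_insert)
qed

lemma H_finite_rcos:
  assumes "subgroup H G" "H_finite G H A" "w \<in> carrier G"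
  shows "H_finite G H (A #> w)"
proof -
  obtain F where F: "finite F" "F \<subseteq> carrier G" "A \<subseteq> (\<Union>g\<in>F. H #> g)"
    using assms(2) unfolding H_finite_def by blast
  have "A #> w \<subseteq> (\<Union>g\<in>(\<lambda>f. f \<otimes> w) ` F. H #> g)"
  proof
    fix x assume "x \<in> A #> w"
    then obtain a where "a \<in> A" "x = a \<otimes> w" by (auto simp: r_coset_def)
    then obtain f where "f \<in> F" "a \<in> H #> f" using F by blast
    then have "x \<in> (H #> f) #> w" using \<open>x = a \<otimes> w\<close> by (auto simp: r_coset_def)
    then have "x \<in> H #> (f \<otimes> w)"
      using coset_mult_assoc[of H f w] \<open>f \<in> F\<close> F(2) assms subgroup.subset[OF assms(1)]
      by blast
    then show "x \<in> (\<Union>g\<in>(\<lambda>f. f \<otimes> w) ` F. H #> g)" using \<open>f \<in> F\<close> by auto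
  qed
  then show ?thesis unfolding H_finite_def
    using F assms(3) by (intro exI[of _ "(\<lambda>f. f \<otimes> w) ` F"]) auto
qed

lemma H_finite_trans:
  assumes "subgroup K G" "H_finite G K H" "H_finite G H A"
  shows "H_finite G K A"
proof -
  obtain F where F: "finite F" "F \<subseteq> carrier G" "A \<subseteq> (\<Union>g\<in>F. H #> g)"
    using assms(3) unfolding H_finite_def by blast
  have "H_finite G K (\<Union>g\<in>F. H #> g)"
    using F(1,2) by (intro H_finite_UN[OF _ H_finite_rcos[OF assms(1,2)]]) auto
  then show ?thesis using F(3) by (rule H_finite_mono)
qed

lemma finite_coset_image_iff:
  assumes "subgroup H G" "A \<subseteq> carrier G"
  shows "finite (coset_image G H A) \<longleftrightarrow> H_finite G H A"
proof
  assume "finite (coset_image G H A)"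
  then obtain F where F: "F \<subseteq> A" "finite F" "coset_image G H A = (\<lambda>x. H #> x) ` F"
    unfolding coset_image_def using finite_subset_image[OF _ subset_refl] by metis
  have "A \<subseteq> (\<Union>g\<in>F. H #> g)"
  proof
    fix a assume "a \<in> A"
    then have "H #> a \<in> (\<lambda>x. H #> x) ` F" using F(3) by (auto simp: coset_image_def)
    moreover have "a \<in> H #> a" using \<open>a \<in> A\<close> assms by (intro rcos_self) auto
    ultimately show "a \<in> (\<Union>g\<in>F. H #> g)" by auto
  qed
  then show "H_finite G H A"
    unfolding H_finite_def using F(1,2) assms(2) by (intro exI[of _ F] conjI) auto
next
  assume "H_finite G H A"
  then obtain F where F: "finite F" "F \<subseteq> carrier G" "A \<subseteq> (\<Union>g\<in>F. H #> g)"
    unfolding H_finite_def by blast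
  have "coset_image G H A \<subseteq> (\<lambda>x. H #> x) ` F"
  proof
    fix C assume "C \<in> coset_image G H A"
    then obtain a where "a \<in> A" "C = H #> a" by (auto simp: coset_image_def)
    then obtain f where "f \<in> F" "a \<in> H #> f" using F by blast
    then have "H #> f = H #> a"
      using F(2) assms(1) by (intro repr_independence) auto
    then show "C \<in> (\<lambda>x. H #> x) ` F" using \<open>C = H #> a\<close> \<open>f \<in> F\<close> by auto
  qed
  then show "finite (coset_image G H A)" using F(1) by (rule finite_subset[OF _ finite_imageI])
qed

lemma coset_image_diff:
  assumes "subgroup H G" "A \<subseteq> carrier G" "B \<subseteq> carrier G" "\<And>h. h \<in> H \<Longrightarrow> h <# B = B"
  shows "coset_image G H (A - B) = coset_image G H A - coset_image G H B"
proof -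
  have "a \<in> B" if "H #> a = H #> b" "a \<in> A" "b \<in> B" for a b
  proof -
    have "a \<in> H #> b" using that assms rcos_self by blast
    then obtain h where "h \<in> H" "a = h \<otimes> b" by (auto simp: r_coset_def)
    then have "a \<in> h <# B" using \<open>b \<in> B\<close> by (auto simp: l_coset_def)
    then show ?thesis using assms(4) \<open>h \<in> H\<close> by blast
  qed
  then show ?thesis unfolding coset_image_def by blast
qed

text \<open>
  Almost invariance read in \<open>G\<close> instead of in the quotient: right translation changes \<open>X\<close> only by an
  \<open>H\<close>-finite set. All later arguments use it in this form.
\<close>

lemma ai_over_iff:
  "ai_over G H X \<longleftrightarrow> subgroup H G \<and> X \<subseteq> carrier G \<and> (\<forall>h\<in>H. h <# X = X) \<and>
     (\<forall>g\<in>carrier G. H_finite G H (sym_diff (X #> g) X))"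
proof -
  have "almost_equal ((\<lambda>C. C #> g) ` coset_image G H X) (coset_image G H X) \<longleftrightarrow>
        H_finite G H (sym_diff (X #> g) X)"
    if H: "subgroup H G" and X: "X \<subseteq> carrier G" and inv: "\<forall>h\<in>H. h <# X = X"
      and g: "g \<in> carrier G" for g
  proof -
    note Hc = subgroup.subset[OF H]
    have Xg: "X #> g \<subseteq> carrier G" using X g by (simp add: r_coset_subset_G)
    have "(\<lambda>C. C #> g) ` coset_image G H X = (\<lambda>x. H #> (x \<otimes> g)) ` X"
      unfolding coset_image_def image_image using Hc X g
      by (intro image_cong) (auto simp: coset_mult_assoc subset_iff)
    also have "\<dots> = coset_image G H (X #> g)"
      unfolding coset_image_def r_coset_def[of G X g] by auto
    finally have 1: "(\<lambda>C. C #> g) ` coset_image G H X = coset_image G H (X #> g)" .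
    have "h <# (X #> g) = X #> g" if "h \<in> H" for h
      using lcos_rcos[of g h X] that inv Hc X g by auto
    then have "coset_image G H ((X #> g) - X) = coset_image G H (X #> g) - coset_image G H X"
      "coset_image G H (X - (X #> g)) = coset_image G H X - coset_image G H (X #> g)"
      using inv coset_image_diff[OF H Xg X] coset_image_diff[OF H X Xg] by blast+
    then have "sym_diff (coset_image G H (X #> g)) (coset_image G H X)
        = coset_image G H ((X #> g) - X) \<union> coset_image G H (X - (X #> g))"
      by (simp only:)
    also have "\<dots> = coset_image G H (sym_diff (X #> g) X)"
      unfolding coset_image_def by (simp only: image_Un)
    finally show ?thesis
      unfolding almost_equal_def 1
      using X Xg finite_coset_image_iff[OF H, of "sym_diff (X #> g) X"] by (simp only:) blast
  qed
  then show ?thesis unfolding ai_over_def almost_invariant_def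
    by (intro conj_cong refl ball_cong)
qed

lemma nontrivial_ai_over_iff:
  "nontrivial_ai_over G H X \<longleftrightarrow>
     ai_over G H X \<and> \<not> H_finite G H X \<and> \<not> H_finite G H (star_compl G X)"
proof -
  have "subgroup H G" "X \<subseteq> carrier G" if "ai_over G H X"
    using that by (auto simp: ai_over_def)
  then show ?thesis
    unfolding nontrivial_ai_over_def
    by (intro conj_cong refl arg_cong[of _ _ Not] finite_coset_image_iff star_compl_subset)
qed

section \<open>Comparing smallness with respect to different subgroups\<close>

text \<open>
  With \<open>w = x'\<inverse> x\<close>, each \<open>s x\<close> lies in \<open>Y\<close> but not in \<open>Y w\<close>, so \<open>S x\<close> is contained in the \<open>K\<close>-finite set
  by which \<open>Y\<close> differs from \<open>Y w\<close>. This plays the part of a path from \<open>s x\<close> to \<open>s x'\<close> in the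
  Cayley graph that has to cross the coboundary of \<open>Y\<close>.
\<close>

lemma H_finite_if_separated:
  assumes "subgroup K G" "Y \<subseteq> carrier G" "\<forall>w\<in>carrier G. H_finite G K (sym_diff (Y #> w) Y)"
    and "S \<subseteq> carrier G" "x \<in> carrier G" "x' \<in> carrier G"
    and "\<And>s. s \<in> S \<Longrightarrow> s \<otimes> x \<in> Y" "\<And>s. s \<in> S \<Longrightarrow> s \<otimes> x' \<notin> Y"
  shows "H_finite G K S"
proof -
  define w where "w = inv x' \<otimes> x"
  have w: "w \<in> carrier G" "inv w = inv x \<otimes> x'" using assms(5,6) by (simp_all add: w_def inv_mult_group)
  have sub: "sym_diff (Y #> w) Y \<subseteq> carrier G" using w assms(2) r_coset_subset_G by blast
  have "S \<subseteq> sym_diff (Y #> w) Y #> inv x"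
  proof
    fix s assume s: "s \<in> S"
    then have sc: "s \<in> carrier G" using assms(4) by blast
    have "s \<otimes> x \<otimes> inv w = s \<otimes> x'"
      using sc assms(5,6) w by (simp add: m_assoc inv_solve_left)
    then have "s \<otimes> x \<notin> Y #> w"
      using mem_rcos[of w Y "s \<otimes> x"] w assms(2) assms(8)[OF s] by simp
    then have "s \<otimes> x \<in> sym_diff (Y #> w) Y" using assms(7)[OF s] by blast
    then show "s \<in> sym_diff (Y #> w) Y #> inv x"
      using mem_rcos[of "inv x" _ s] sub sc assms(5) by simp
  qed
  moreover have "H_finite G K (sym_diff (Y #> w) Y #> inv x)"
    using assms w by (intro H_finite_rcos) auto
  ultimately show ?thesis by (rule H_finite_mono[rotated])
qed

lemma not_H_finiteE:
  assumes "\<not> H_finite G H X" "finite F" "F \<subseteq> carrier G"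
  obtains x where "x \<in> X" "x \<notin> (\<Union>g\<in>F. H #> g)"
  using assms unfolding H_finite_def by blast

lemma mem_invariant:
  assumes "subgroup H G" "X \<subseteq> carrier G" "\<forall>h\<in>H. h <# X = X" "h \<in> H" "x \<in> carrier G"
  shows "h \<otimes> x \<in> X \<longleftrightarrow> x \<in> X"
proof -
  have h: "h \<in> carrier G" using subgroup.mem_carrier[OF assms(1,4)] .
  have "h \<otimes> x \<in> h <# X \<longleftrightarrow> x \<in> X"
    using mem_lcos[OF h assms(2), of "h \<otimes> x"] h assms(5) by (simp add: m_assoc[symmetric])
  then show ?thesis using assms(3,4) by simp
qed

lemma mem_rcos_UN_invariant:
  assumes "subgroup H G" "F \<subseteq> carrier G" "h \<in> H" "x \<in> carrier G" "h \<otimes> x \<in> (\<Union>g\<in>F. H #> g)"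
  shows "x \<in> (\<Union>g\<in>F. H #> g)"
proof -
  obtain f k where f: "f \<in> F" "k \<in> H" "h \<otimes> x = k \<otimes> f"
    using assms(5) by (auto simp: r_coset_def)
  have c: "h \<in> carrier G" "k \<in> carrier G" "f \<in> carrier G"
    using f assms subgroup.mem_carrier[OF assms(1)] by auto
  have "x = inv h \<otimes> (h \<otimes> x)" using c assms(4) by (simp add: m_assoc[symmetric])
  also have "\<dots> = (inv h \<otimes> k) \<otimes> f" using c f(3) by (simp add: m_assoc)
  finally have "x \<in> H #> f"
    using assms(1,3) f(2) unfolding r_coset_def
    by (auto intro: subgroup.m_closed subgroup.m_inv_closed)
  then show ?thesis using f(1) by blast
qed

text \<open>
  Equivalent almost invariant sets have commensurable subgroups. Take \<open>x \<in> X\<close> and \<open>x' \<notin> X\<close> outside an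
  \<open>H\<close>-invariant, \<open>H\<close>-finite set containing the symmetric difference. Then \<open>x\<close> and \<open>x'\<close> are separated
  by \<open>Y\<close>, and remain so after translation by any element of \<open>H\<close> and by any element of \<open>K\<close>, so that
  \<open>H_finite_if_separated\<close> applies in both directions.
\<close>

lemma H_finite_cong_of_equiv:
  assumes X: "nontrivial_ai_over G H X" and Y: "ai_over G K Y"
    and XY: "H_finite G H (sym_diff X Y)"
  shows "H_finite G H A \<longleftrightarrow> H_finite G K A"
proof -
  have H: "subgroup H G" "X \<subseteq> carrier G" "\<forall>h\<in>H. h <# X = X"
    "\<forall>w\<in>carrier G. H_finite G H (sym_diff (X #> w) X)"
    "\<not> H_finite G H X" "\<not> H_finite G H (star_compl G X)"
    using X unfolding nontrivial_ai_over_iff ai_over_iff by blast+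
  have K: "subgroup K G" "Y \<subseteq> carrier G" "\<forall>k\<in>K. k <# Y = Y"
    "\<forall>w\<in>carrier G. H_finite G K (sym_diff (Y #> w) Y)"
    using Y unfolding ai_over_iff by blast+
  obtain F where F: "finite F" "F \<subseteq> carrier G" "sym_diff X Y \<subseteq> (\<Union>g\<in>F. H #> g)"
    using XY unfolding H_finite_def by blast
  obtain x where x: "x \<in> X" "x \<notin> (\<Union>g\<in>F. H #> g)" using not_H_finiteE[OF H(5) F(1,2)] .
  obtain x' where x': "x' \<in> star_compl G X" "x' \<notin> (\<Union>g\<in>F. H #> g)"
    using not_H_finiteE[OF H(6) F(1,2)] .
  have xc: "x \<in> carrier G" "x' \<in> carrier G" "x' \<notin> X"
    using x(1) x'(1) H(2) by (auto simp: star_compl_def)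
  have "H_finite G K H"
  proof (rule H_finite_if_separated[OF K(1,2,4) subgroup.subset[OF H(1)] xc(1,2)])
    fix h assume h: "h \<in> H"
    show "h \<otimes> x \<in> Y"
      using mem_invariant[OF H(1-3) h xc(1)] mem_rcos_UN_invariant[OF H(1) F(2) h xc(1)] x F(3)
      by blast
    show "h \<otimes> x' \<notin> Y"
      using mem_invariant[OF H(1-3) h xc(2)] mem_rcos_UN_invariant[OF H(1) F(2) h xc(2)] x' xc F(3)
      by blast
  qed
  moreover have "H_finite G H K"
  proof (rule H_finite_if_separated[OF H(1) K(2) _ subgroup.subset[OF K(1)] xc(1,2)])
    show "\<forall>w\<in>carrier G. H_finite G H (sym_diff (Y #> w) Y)"
    proof
      fix w assume w: "w \<in> carrier G"
      have "sym_diff (Y #> w) Y \<subseteq> (sym_diff X Y #> w) \<union> sym_diff (X #> w) X \<union> sym_diff X Y"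
        unfolding r_coset_def by auto
      moreover have "H_finite G H (sym_diff (X #> w) X)" using H(4) w by (rule bspec)
      ultimately show "H_finite G H (sym_diff (Y #> w) Y)"
        by (rule H_finite_mono[rotated, OF _ H_finite_Un[OF H_finite_Un[OF H_finite_rcos[OF H(1) XY w]] XY]])
    qed
    fix k assume k: "k \<in> K"
    have "x \<in> Y" "x' \<notin> Y" using x x' xc F(3) by blast+
    then show "k \<otimes> x \<in> Y" "k \<otimes> x' \<notin> Y"
      using mem_invariant[OF K(1-3) k] xc by blast+
  qed
  ultimately show ?thesis using H_finite_trans[OF H(1)] H_finite_trans[OF K(1)] by metis
qed

lemma nontrivial_ai_over_if_equiv:
  assumes X: "nontrivial_ai_over G H X" and Y: "ai_over G K Y"
    and XY: "H_finite G H (sym_diff X Y)"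
  shows "nontrivial_ai_over G K Y"
proof -
  have c: "X \<subseteq> carrier G" "Y \<subseteq> carrier G" using X Y
    unfolding nontrivial_ai_over_iff ai_over_iff by blast+
  have "X \<subseteq> Y \<union> sym_diff X Y" "star_compl G X \<subseteq> star_compl G Y \<union> sym_diff X Y"
    by (auto simp: star_compl_def)
  moreover have "\<not> H_finite G H X" "\<not> H_finite G H (star_compl G X)"
    using X unfolding nontrivial_ai_over_iff by blast+
  ultimately have "\<not> H_finite G H Y" "\<not> H_finite G H (star_compl G Y)"
    using H_finite_mono[OF H_finite_Un[OF _ XY]] by metis+
  then show ?thesis
    using Y H_finite_cong_of_equiv[OF X Y XY] unfolding nontrivial_ai_over_iff by blast
qed

text \<open>
  Smallness of a corner does not depend on which of the two subgroups is used. If \<open>X \<inter> Y\<close> lies in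
  \<open>H F\<close> with \<open>F\<close> finite, pick \<open>x \<in> X\<close> outside \<open>H F\<close>. For \<open>p = h f\<close> in the corner, \<open>h x\<close> lies in
  \<open>X\<close> but not in \<open>H F\<close>, hence not in \<open>Y\<close>. So \<open>Y\<close> separates \<open>p\<close> from \<open>p (f\<inverse> x)\<close>, where
  \<open>f\<inverse> x\<close> ranges over a finite set.
\<close>

lemma H_finite_corner_sym:
  assumes X: "nontrivial_ai_over G H X" and Y: "ai_over G K Y" and fin: "H_finite G H (X \<inter> Y)"
  shows "H_finite G K (X \<inter> Y)"
proof -
  have H: "subgroup H G" "X \<subseteq> carrier G" "\<forall>h\<in>H. h <# X = X" "\<not> H_finite G H X"
    using X unfolding nontrivial_ai_over_iff ai_over_iff by blast+
  have K: "subgroup K G" "Y \<subseteq> carrier G" "\<forall>w\<in>carrier G. H_finite G K (sym_diff (Y #> w) Y)"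
    using Y unfolding ai_over_iff by blast+
  obtain F where F: "finite F" "F \<subseteq> carrier G" "X \<inter> Y \<subseteq> (\<Union>g\<in>F. H #> g)"
    using fin unfolding H_finite_def by blast
  obtain x where x: "x \<in> X" "x \<notin> (\<Union>g\<in>F. H #> g)" using not_H_finiteE[OF H(4) F(1,2)] .
  have xc: "x \<in> carrier G" using x H by blast
  have "H_finite G K (X \<inter> Y \<inter> (H #> f))" if f: "f \<in> F" for f
  proof (rule H_finite_if_separated[OF K, of _ \<one> "inv f \<otimes> x"])
    have fc: "f \<in> carrier G" using f F by blast
    show "X \<inter> Y \<inter> (H #> f) \<subseteq> carrier G" "\<one> \<in> carrier G" "inv f \<otimes> x \<in> carrier G"
      using K fc xc by auto
    fix s assume s: "s \<in> X \<inter> Y \<inter> (H #> f)"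
    then show "s \<otimes> \<one> \<in> Y" using K by auto
    obtain h where h: "h \<in> H" "s = h \<otimes> f" using s by (auto simp: r_coset_def)
    have hc: "h \<in> carrier G" using h H subgroup.mem_carrier by metis
    have "s \<otimes> (inv f \<otimes> x) = h \<otimes> (f \<otimes> (inv f \<otimes> x))"
      using h hc fc xc by (simp add: m_assoc)
    also have "\<dots> = h \<otimes> x" using fc xc by (simp add: m_assoc[symmetric])
    finally have "s \<otimes> (inv f \<otimes> x) = h \<otimes> x" .
    moreover have "h \<otimes> x \<notin> Y"
      using mem_invariant[OF H(1-3) h(1) xc] mem_rcos_UN_invariant[OF H(1) F(2) h(1) xc] x F(3)
      by blast
    ultimately show "s \<otimes> (inv f \<otimes> x) \<notin> Y" by simp
  qed
  then have "H_finite G K (\<Union>f\<in>F. X \<inter> Y \<inter> (H #> f))" using F(1) by (rule H_finite_UN[rotated])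
  then show ?thesis by (rule H_finite_mono) (use F(3) in blast)
qed

section \<open>Translation of almost invariant sets and their equivalence\<close>

lemma mem_conj_subgroup:
  assumes "g \<in> carrier G" "H \<subseteq> carrier G"
  shows "x \<in> conj_subgroup G g H \<longleftrightarrow> x \<in> carrier G \<and> inv g \<otimes> x \<otimes> g \<in> H"
  unfolding conj_subgroup_def
  using assms by (auto simp: mem_rcos mem_lcos l_coset_subset_G m_assoc)

lemma subgroup_conj_subgroup:
  assumes g: "g \<in> carrier G" and H: "subgroup H G"
  shows "subgroup (conj_subgroup G g H) G"
proof (rule subgroupI)
  note mem = mem_conj_subgroup[OF g subgroup.subset[OF H]]
  show "conj_subgroup G g H \<subseteq> carrier G" by (auto simp: mem)
  have "\<one> \<in> conj_subgroup G g H" using g subgroup.one_closed[OF H] by (simp add: mem)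
  then show "conj_subgroup G g H \<noteq> {}" by blast
  fix a assume a: "a \<in> conj_subgroup G g H"
  then have "inv (inv g \<otimes> a \<otimes> g) \<in> H" using subgroup.m_inv_closed[OF H] by (simp add: mem)
  then show "inv a \<in> conj_subgroup G g H"
    using a g by (simp add: mem inv_mult_group m_assoc)
  fix b assume b: "b \<in> conj_subgroup G g H"
  have ab: "a \<in> carrier G" "b \<in> carrier G" using a b by (simp_all add: mem)
  have "inv g \<otimes> (a \<otimes> b) \<otimes> g = (inv g \<otimes> a) \<otimes> (b \<otimes> g)"
    using ab g by (simp add: m_assoc)
  also have "\<dots> = (inv g \<otimes> a) \<otimes> (g \<otimes> (inv g \<otimes> (b \<otimes> g)))"
    using ab g by (simp add: m_assoc[symmetric, of g])
  also have "\<dots> = (inv g \<otimes> a \<otimes> g) \<otimes> (inv g \<otimes> b \<otimes> g)"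
    using ab g by (simp add: m_assoc)
  finally show "a \<otimes> b \<in> conj_subgroup G g H"
    using a b subgroup.m_closed[OF H] ab by (simp add: mem)
qed

lemma conj_subgroup_inv:
  assumes "g \<in> carrier G" "H \<subseteq> carrier G"
  shows "conj_subgroup G (inv g) (conj_subgroup G g H) = H"
proof -
  have "conj_subgroup G g H \<subseteq> carrier G" using assms by (auto simp: mem_conj_subgroup)
  moreover have "inv g \<otimes> (g \<otimes> x \<otimes> inv g) \<otimes> g = x" if "x \<in> carrier G" for x
    using that assms(1) by (simp add: m_assoc) (simp add: m_assoc[symmetric])
  ultimately show ?thesis
    using assms by (auto simp: mem_conj_subgroup subsetD[OF assms(2)])
qed

lemma rcos_conj_subgroup:
  assumes g: "g \<in> carrier G" and H: "H \<subseteq> carrier G" and x: "x \<in> carrier G"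
  shows "conj_subgroup G g H #> (g \<otimes> x) = g <# (H #> x)"
proof -
  have "conj_subgroup G g H #> (g \<otimes> x) = (g <# H) #> (inv g \<otimes> (g \<otimes> x))"
    unfolding conj_subgroup_def using g H x by (simp add: coset_mult_assoc l_coset_subset_G)
  also have "inv g \<otimes> (g \<otimes> x) = x" using g x by (simp add: m_assoc[symmetric])
  also have "(g <# H) #> x = g <# (H #> x)" using lcos_rcos[OF x g H] by simp
  finally show ?thesis .
qed

lemma H_finite_conj:
  assumes g: "g \<in> carrier G" and H: "subgroup H G" and A: "H_finite G H A"
  shows "H_finite G (conj_subgroup G g H) (g <# A)"
proof -
  obtain F where F: "finite F" "F \<subseteq> carrier G" "A \<subseteq> (\<Union>f\<in>F. H #> f)"
    using A unfolding H_finite_def by blast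
  have "g <# A \<subseteq> g <# (\<Union>f\<in>F. H #> f)" using F(3) by (rule lcos_mono)
  also have "\<dots> = (\<Union>f\<in>F. g <# (H #> f))" by (auto simp: l_coset_def)
  also have "\<dots> = (\<Union>f\<in>F. conj_subgroup G g H #> (g \<otimes> f))"
    using F(2) by (intro SUP_cong refl rcos_conj_subgroup[symmetric] g subgroup.subset[OF H]) auto
  finally show ?thesis
    unfolding H_finite_def using F(1,2) g by (intro exI[of _ "(\<lambda>f. g \<otimes> f) ` F"] conjI) auto
qed

lemma H_finite_conj_iff:
  assumes g: "g \<in> carrier G" and H: "subgroup H G" and A: "A \<subseteq> carrier G"
  shows "H_finite G (conj_subgroup G g H) (g <# A) \<longleftrightarrow> H_finite G H A"
  using H_finite_conj[OF g H, of A]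
    H_finite_conj[OF inv_closed[OF g] subgroup_conj_subgroup[OF g H], of "g <# A"]
    conj_subgroup_inv[OF g subgroup.subset[OF H]] lcos_inv_cancel[OF g A] by auto

lemma ai_over_lcos:
  assumes X: "ai_over G H X" and g: "g \<in> carrier G"
  shows "ai_over G (conj_subgroup G g H) (g <# X)"
proof -
  have H: "subgroup H G" "X \<subseteq> carrier G" "\<forall>h\<in>H. h <# X = X"
    "\<forall>w\<in>carrier G. H_finite G H (sym_diff (X #> w) X)"
    using X unfolding ai_over_iff by blast+
  have "k <# (g <# X) = g <# X" if k: "k \<in> conj_subgroup G g H" for k
  proof -
    have k': "k \<in> carrier G" "inv g \<otimes> k \<otimes> g \<in> H"
      using k mem_conj_subgroup[OF g subgroup.subset[OF H(1)]] by auto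
    have "k <# (g <# X) = (g \<otimes> (inv g \<otimes> k \<otimes> g)) <# X"
      using k' g H(2) by (simp add: lcos_m_assoc m_assoc[symmetric])
    also have "\<dots> = g <# ((inv g \<otimes> k \<otimes> g) <# X)"
      using k' g H(2) by (subst lcos_m_assoc) auto
    finally show ?thesis using H(3) k'(2) by simp
  qed
  moreover have "H_finite G (conj_subgroup G g H) (sym_diff ((g <# X) #> w) (g <# X))"
    if w: "w \<in> carrier G" for w
  proof -
    have Xw: "X #> w \<subseteq> carrier G" using H(2) w by (simp add: r_coset_subset_G)
    have "sym_diff ((g <# X) #> w) (g <# X) = g <# sym_diff (X #> w) X"
      using g H(2) Xw w by (simp add: lcos_Un lcos_diff lcos_rcos)
    then show ?thesis using H_finite_conj[OF g H(1)] H(4) w by auto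
  qed
  ultimately show ?thesis
    unfolding ai_over_iff using subgroup_conj_subgroup[OF g H(1)] H(2) g
    by (simp add: l_coset_subset_G)
qed

lemma nontrivial_ai_over_lcos:
  assumes X: "nontrivial_ai_over G H X" and g: "g \<in> carrier G"
  shows "nontrivial_ai_over G (conj_subgroup G g H) (g <# X)"
proof -
  have H: "ai_over G H X" "subgroup H G" "X \<subseteq> carrier G"
    "\<not> H_finite G H X" "\<not> H_finite G H (star_compl G X)"
    using X unfolding nontrivial_ai_over_iff ai_over_iff by blast+
  then show ?thesis
    unfolding nontrivial_ai_over_iff lcos_star_compl[OF g H(3), symmetric]
    using ai_over_lcos[OF _ g] H_finite_conj_iff[OF g] star_compl_subset by simp
qed

lemma subgroup_translate_stab:
  assumes "U \<subseteq> carrier G"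
  shows "subgroup (translate_stab G U) G"
proof (rule subgroupI)
  show "translate_stab G U \<subseteq> carrier G" by (auto simp: translate_stab_def)
  have "\<one> \<in> translate_stab G U" using assms by (simp add: translate_stab_def lcos_mult_one)
  then show "translate_stab G U \<noteq> {}" by blast
  fix a assume a: "a \<in> translate_stab G U"
  then show "inv a \<in> translate_stab G U"
    using lcos_inv_cancel[OF _ assms, of a] by (simp add: translate_stab_def)
  fix b assume "b \<in> translate_stab G U"
  then show "a \<otimes> b \<in> translate_stab G U"
    using a assms lcos_m_assoc[OF assms, of a b] by (simp add: translate_stab_def)
qed

lemma translate_stab_lcos:
  assumes g: "g \<in> carrier G" and U: "U \<subseteq> carrier G"
  shows "translate_stab G (g <# U) = conj_subgroup G g (translate_stab G U)"
proof -
  have "x <# (g <# U) = g <# U \<longleftrightarrow> (inv g \<otimes> x \<otimes> g) <# U = U" if x: "x \<in> carrier G" for x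
  proof -
    have "(inv g \<otimes> x \<otimes> g) <# U = inv g <# (x <# (g <# U))"
      using x g U by (simp add: lcos_m_assoc m_assoc)
    then show ?thesis
      using lcos_inv_cancel[OF g U]
        lcos_inv_cancel[OF g l_coset_subset_G[OF l_coset_subset_G[OF U g] x]] by metis
  qed
  moreover have "translate_stab G U \<subseteq> carrier G" by (auto simp: translate_stab_def)
  ultimately show ?thesis
    using g mem_conj_subgroup[OF g, of "translate_stab G U"] by (auto simp: translate_stab_def)
qed

lemma translate_stab_star_compl:
  assumes "U \<subseteq> carrier G"
  shows "translate_stab G (star_compl G U) = translate_stab G U"
proof -
  have "g <# star_compl G U = star_compl G U \<longleftrightarrow> g <# U = U" if "g \<in> carrier G" for g
    using lcos_star_compl[OF that assms] star_compl_star_compl[OF assms]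
      star_compl_star_compl[OF l_coset_subset_G[OF assms that]] by metis
  then show ?thesis by (auto simp: translate_stab_def)
qed

lemma ai_over_star_compl:
  assumes "ai_over G H X"
  shows "ai_over G H (star_compl G X)"
proof -
  have H: "subgroup H G" "X \<subseteq> carrier G" "\<forall>h\<in>H. h <# X = X"
    "\<forall>w\<in>carrier G. H_finite G H (sym_diff (X #> w) X)"
    using assms unfolding ai_over_iff by blast+
  have "sym_diff (star_compl G X #> w) (star_compl G X) = sym_diff (X #> w) X"
    if "w \<in> carrier G" for w
    using that H(2) by (simp only: rcos_star_compl sym_diff_star_compl r_coset_subset_G)
  then show ?thesis
    unfolding ai_over_iff
    using H star_compl_subset lcos_star_compl subgroup.mem_carrier[OF H(1)] by auto
qed

lemma nontrivial_ai_over_translate_stab: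
  assumes "nontrivial_ai_over G H U"
  shows "nontrivial_ai G U" "H_finite G H A \<longleftrightarrow> H_finite G (translate_stab G U) A"
proof -
  have H: "subgroup H G" "U \<subseteq> carrier G" "\<forall>h\<in>H. h <# U = U"
    "\<forall>w\<in>carrier G. H_finite G H (sym_diff (U #> w) U)"
    using assms unfolding nontrivial_ai_over_iff ai_over_iff by blast+
  have "H \<subseteq> translate_stab G U"
    using H(3) subgroup.mem_carrier[OF H(1)] by (auto simp: translate_stab_def)
  then have "H \<subseteq> translate_stab G U #> \<one>"
    using subgroup.subset[OF subgroup_translate_stab[OF H(2)]] by simp
  then have "H_finite G (translate_stab G U) H"
    unfolding H_finite_def by (intro exI[of _ "{\<one>}"]) simp
  then have "H_finite G (translate_stab G U) A" if "H_finite G H A" for A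
    using that by (rule H_finite_trans[OF subgroup_translate_stab[OF H(2)]])
  then have ai: "ai_over G (translate_stab G U) U"
    unfolding ai_over_iff using H subgroup_translate_stab[OF H(2)]
    by (auto simp: translate_stab_def)
  have self: "H_finite G H (sym_diff U U)" by (simp add: H_finite_empty)
  show "H_finite G H A \<longleftrightarrow> H_finite G (translate_stab G U) A"
    by (rule H_finite_cong_of_equiv[OF assms ai self])
  show "nontrivial_ai G U"
    unfolding nontrivial_ai_def by (rule nontrivial_ai_over_if_equiv[OF assms ai self])
qed

lemma nontrivial_aiD:
  assumes "nontrivial_ai G U"
  shows "ai_over G (translate_stab G U) U" "U \<subseteq> carrier G" "subgroup (translate_stab G U) G"
    "\<not> H_finite G (translate_stab G U) U" "\<not> H_finite G (translate_stab G U) (star_compl G U)"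
  using assms unfolding nontrivial_ai_def nontrivial_ai_over_iff ai_over_iff by blast+

lemma nontrivial_ai_lcos:
  assumes "nontrivial_ai G U" "g \<in> carrier G"
  shows "nontrivial_ai G (g <# U)"
  using nontrivial_ai_over_lcos[OF assms[unfolded nontrivial_ai_def]]
  by (rule nontrivial_ai_over_translate_stab(1))

lemma nontrivial_ai_star_compl:
  assumes "nontrivial_ai G U"
  shows "nontrivial_ai G (star_compl G U)"
  using nontrivial_aiD[OF assms] ai_over_star_compl
  unfolding nontrivial_ai_def nontrivial_ai_over_iff
  by (simp add: translate_stab_star_compl star_compl_star_compl)

text \<open>
  The last fact, by which equivalent sets have the same small subsets, makes \<open>ai_sim\<close> symmetric and
  transitive.
\<close>

lemma ai_simD:
  assumes "ai_sim G U V"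
  shows "nontrivial_ai G U" "nontrivial_ai G V" "U \<subseteq> carrier G" "V \<subseteq> carrier G"
    "H_finite G (translate_stab G U) (sym_diff U V)"
    "H_finite G (translate_stab G U) A \<longleftrightarrow> H_finite G (translate_stab G V) A"
proof -
  show *: "nontrivial_ai G U" "nontrivial_ai G V"
    "H_finite G (translate_stab G U) (sym_diff U V)"
    using assms by (simp_all add: ai_sim_def)
  show "U \<subseteq> carrier G" "V \<subseteq> carrier G" using *(1,2) by (auto dest: nontrivial_aiD)
  show "H_finite G (translate_stab G U) A \<longleftrightarrow> H_finite G (translate_stab G V) A"
    by (rule H_finite_cong_of_equiv[OF *(1)[unfolded nontrivial_ai_def] nontrivial_aiD(1)[OF *(2)] *(3)])
qed

lemma ai_sim_refl: "nontrivial_ai G U \<Longrightarrow> ai_sim G U U"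
  by (simp add: ai_sim_def H_finite_empty)

lemma ai_sim_sym:
  assumes "ai_sim G U V"
  shows "ai_sim G V U"
  using ai_simD[OF assms] by (simp add: ai_sim_def Un_commute)

lemma ai_sim_trans:
  assumes UV: "ai_sim G U V" and VW: "ai_sim G V W"
  shows "ai_sim G U W"
proof -
  have "H_finite G (translate_stab G U) (sym_diff U V \<union> sym_diff V W)"
    using ai_simD(5,6)[OF UV] ai_simD(5)[OF VW] H_finite_Un by metis
  then have "H_finite G (translate_stab G U) (sym_diff U W)"
    by (rule H_finite_mono) blast
  then show ?thesis using UV VW by (simp add: ai_sim_def)
qed

lemma ai_sim_lcos:
  assumes "ai_sim G U V" "g \<in> carrier G"
  shows "ai_sim G (g <# U) (g <# V)"
proof -
  note D = ai_simD[OF assms(1)]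
  have "sym_diff (g <# U) (g <# V) = g <# sym_diff U V"
    using D(3,4) assms(2) by (simp add: lcos_Un lcos_diff)
  then show ?thesis
    unfolding ai_sim_def using D assms(2) nontrivial_ai_lcos
      H_finite_conj[OF assms(2) nontrivial_aiD(3)[OF D(1)] D(5)]
    by (simp add: translate_stab_lcos)
qed

lemma ai_sim_star_compl:
  assumes "ai_sim G U V"
  shows "ai_sim G (star_compl G U) (star_compl G V)"
  using ai_simD(1-5)[OF assms]
  by (simp add: ai_sim_def nontrivial_ai_star_compl sym_diff_star_compl translate_stab_star_compl)

lemma ai_sim_if_equiv_over:
  assumes "nontrivial_ai_over G H X" "ai_equiv_over G H X K Y"
  shows "ai_sim G X Y"
proof -
  have Y: "ai_over G K Y" and fin: "H_finite G H (sym_diff X Y)"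
    using assms(2) by (simp_all add: ai_equiv_over_def)
  have "nontrivial_ai_over G K Y" by (rule nontrivial_ai_over_if_equiv[OF assms(1) Y fin])
  then show ?thesis
    using nontrivial_ai_over_translate_stab[OF assms(1)] fin
      nontrivial_ai_over_translate_stab(1)[of K Y] by (simp add: ai_sim_def)
qed

end

section \<open>Equivalence classes are chains with a common stabiliser\<close>

text \<open>
  The consequence of good position that the argument runs on, for families closed under
  translation and complementation.
\<close>

definition nested_classes :: "('a, 'b) monoid_scheme \<Rightarrow> 'a set set \<Rightarrow> bool" where
  "nested_classes G E \<longleftrightarrow>
     (\<forall>U\<in>E. nontrivial_ai G U \<and> star_compl G U \<in> E \<and> (\<forall>g\<in>carrier G. g <#\<^bsub>G\<^esub> U \<in> E)) \<and>
     (\<forall>U\<in>E. \<forall>V\<in>E. ai_sim G U V \<longrightarrow> U \<subseteq> V \<or> V \<subseteq> U)"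

text \<open>
  How much larger \<open>U\<close> is than \<open>V\<close>, counted in cosets of the stabiliser of \<open>U\<close>. It is meaningful for
  equivalent sets with the same stabiliser.
\<close>

definition signed_diff :: "('a, 'b) monoid_scheme \<Rightarrow> 'a set \<Rightarrow> 'a set \<Rightarrow> int" where
  "signed_diff G U V =
     int (card (coset_image G (translate_stab G U) (U - V))) -
     int (card (coset_image G (translate_stab G U) (V - U)))"

context group
begin

lemma small_corner_iff:
  assumes "nontrivial_ai G U" "nontrivial_ai G V"
  shows "small_corner G U V C \<longleftrightarrow> C \<in> corners G U V \<and> H_finite G (translate_stab G U) C"
  using nontrivial_ai_over_translate_stab(2) assms
  unfolding small_corner_def nontrivial_ai_def by metis

lemma mem_translate_stab:
  assumes "s \<in> translate_stab G U" "U \<subseteq> carrier G" "x \<in> carrier G"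
  shows "s \<otimes> x \<in> U \<longleftrightarrow> x \<in> U"
  using assms(1) by (intro mem_invariant[OF subgroup_translate_stab[OF assms(2)] assms(2) _ _ assms(3)])
    (simp_all add: translate_stab_def)

lemma nested_classesD:
  assumes "nested_classes G E" "U \<in> E"
  shows "nontrivial_ai G U" "U \<subseteq> carrier G" "star_compl G U \<in> E"
    "g \<in> carrier G \<Longrightarrow> g <# U \<in> E"
    "\<lbrakk>V \<in> E; ai_sim G U V\<rbrakk> \<Longrightarrow> U \<subseteq> V \<or> V \<subseteq> U"
  using assms nontrivial_aiD(2) unfolding nested_classes_def by blast+

lemma E_setI:
  assumes "i \<in> {1..n}" "g \<in> carrier G"
  shows "g <# Y i \<in> E_set G n Y" "star_compl G (g <# Y i) \<in> E_set G n Y"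
  using assms unfolding E_set_def by blast+

text \<open>
  For equivalent sets the two corners \<open>U \<inter> V\<^sup>*\<close> and \<open>U\<^sup>* \<inter> V\<close> are small, so some corner is empty; it
  cannot be one of the other two, since then \<open>U\<close> or \<open>U\<^sup>*\<close> would be small.
\<close>

lemma nested_if_good_position:
  assumes good: "good_position G n Y" and U: "U \<in> E_set G n Y" and V: "V \<in> E_set G n Y"
    and UV: "ai_sim G U V"
  shows "U \<subseteq> V \<or> V \<subseteq> U"
proof -
  note D = ai_simD[OF UV]
  let ?S = "translate_stab G U"
  have sub: "U \<inter> star_compl G V \<subseteq> sym_diff U V" "star_compl G U \<inter> V \<subseteq> sym_diff U V"
    by (auto simp: star_compl_def)
  note fin = H_finite_mono[OF D(5) sub(1)] H_finite_mono[OF D(5) sub(2)]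
  have "{} \<in> corners G U V"
  proof (cases "U \<inter> star_compl G V = star_compl G U \<inter> V")
    case True
    then have "U \<inter> star_compl G V = {}" by (auto simp: star_compl_def)
    then show ?thesis by (auto simp: corners_def)
  next
    case False
    moreover have "small_corner G U V (U \<inter> star_compl G V)" "small_corner G U V (star_compl G U \<inter> V)"
      using fin by (simp_all add: small_corner_iff[OF D(1,2)] corners_def)
    ultimately show ?thesis
      by (intro good[unfolded good_position_def, rule_format, OF U V] exI conjI)
  qed
  moreover have "U \<inter> V \<noteq> {}"
  proof
    assume "U \<inter> V = {}"
    then have "U \<subseteq> U \<inter> star_compl G V" using D(3) by (auto simp: star_compl_def)
    then have "H_finite G ?S U" by (rule H_finite_mono[OF fin(1)])
    then show False using nontrivial_aiD[OF D(1)] by blast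
  qed
  moreover have "star_compl G U \<inter> star_compl G V \<noteq> {}"
  proof
    assume "star_compl G U \<inter> star_compl G V = {}"
    then have "star_compl G U \<subseteq> star_compl G U \<inter> V" by (auto simp: star_compl_def)
    then have "H_finite G ?S (star_compl G U)" by (rule H_finite_mono[OF fin(2)])
    then show False using nontrivial_aiD[OF D(1)] by blast
  qed
  ultimately have "star_compl G U \<inter> V = {} \<or> U \<inter> star_compl G V = {}"
    by (auto simp: corners_def)
  then show ?thesis using D(3,4) by (auto simp: star_compl_def)
qed

lemma nested_classes_E_set:
  assumes good: "good_position G n Y" and Y: "\<And>i. i \<in> {1..n} \<Longrightarrow> nontrivial_ai G (Y i)"
  shows "nested_classes G (E_set G n Y)"
proof -
  have "nontrivial_ai G U \<and> star_compl G U \<in> E_set G n Y \<and> (\<forall>h\<in>carrier G. h <# U \<in> E_set G n Y)"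
    if U: "U \<in> E_set G n Y" for U
  proof -
    obtain g i where gi: "g \<in> carrier G" "i \<in> {1..n}"
      and or: "U = g <# Y i \<or> U = star_compl G (g <# Y i)"
      using U unfolding E_set_def by blast
    have Yi: "Y i \<subseteq> carrier G" "nontrivial_ai G (Y i)"
      using Y[OF gi(2)] by (auto dest: nontrivial_aiD)
    note gY = l_coset_subset_G[OF Yi(1) gi(1)] nontrivial_ai_lcos[OF Yi(2) gi(1)]
    have "h <# U \<in> E_set G n Y" if h: "h \<in> carrier G" for h
      using or E_setI[OF gi(2), of "h \<otimes> g"] h gi(1) Yi(1) gY(1)
      by (auto simp: lcos_star_compl lcos_m_assoc)
    moreover have "star_compl G U \<in> E_set G n Y"
      using or E_setI[OF gi(2,1)] gY by (auto simp: star_compl_star_compl)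
    moreover have "nontrivial_ai G U" using or gY nontrivial_ai_star_compl by blast
    ultimately show ?thesis by blast
  qed
  then show ?thesis
    unfolding nested_classes_def using nested_if_good_position[OF good] by blast
qed

lemma nat_pow_lcos_subset:
  assumes "k \<in> carrier G" "U \<subseteq> carrier G" "k <# U \<subseteq> U"
  shows "k [^] (m::nat) <# U \<subseteq> U"
proof (induction m)
  case 0
  show ?case using assms(2) by (simp add: lcos_mult_one)
next
  case (Suc m)
  have "k [^] Suc m <# U = k [^] m <# (k <# U)"
    using assms(1,2) by (simp add: lcos_m_assoc)
  also have "\<dots> \<subseteq> k [^] m <# U" using assms(3) by (rule lcos_mono)
  finally show ?case using Suc by blast
qed

lemma lcos_eq_if_nat_pow:
  assumes k: "k \<in> carrier G" and U: "U \<subseteq> carrier G" and sub: "k <# U \<subseteq> U"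
    and m: "m > 0" "k [^] (m::nat) <# U = U"
  shows "k <# U = U"
proof -
  obtain l where l: "m = Suc l" using m(1) gr0_implies_Suc by blast
  have "U = k <# (k [^] l <# U)"
    using m(2) lcos_m_assoc[OF U k nat_pow_closed[OF k], of l]
    unfolding l nat_pow_Suc2[OF k] by simp
  also have "\<dots> \<subseteq> k <# U" using nat_pow_lcos_subset[OF k U sub] by (rule lcos_mono)
  finally show ?thesis using sub by blast
qed

text \<open>
  The stabilisers of equivalent sets are commensurable, so two powers of \<open>k\<close> lie in the same
  coset of the stabiliser of \<open>U\<close>.
\<close>

lemma nat_pow_mem_translate_stab:
  assumes UV: "ai_sim G U V" and k: "k \<in> translate_stab G V"
  obtains m :: nat where "m > 0" "k [^] m \<in> translate_stab G U"
proof -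
  let ?S = "translate_stab G U" and ?T = "translate_stab G V"
  note D = ai_simD[OF UV]
  have S: "subgroup ?S G" and T: "subgroup ?T G" using nontrivial_aiD(3) D(1,2) by blast+
  have kc: "k \<in> carrier G" using k T subgroup.mem_carrier by metis
  have "?T \<subseteq> ?T #> \<one>" using subgroup.subset[OF T] by simp
  then have "H_finite G ?T ?T" unfolding H_finite_def by (intro exI[of _ "{\<one>}"]) simp
  then have "finite (coset_image G ?S ?T)"
    using D(6) finite_coset_image_iff[OF S subgroup.subset[OF T]] by simp
  moreover have pow: "k [^] i \<in> ?T" for i :: nat
    using k kc T by (induction i) (auto intro: subgroup.one_closed subgroup.m_closed)
  then have "range (\<lambda>i::nat. ?S #> k [^] i) \<subseteq> coset_image G ?S ?T"
    by (auto simp: coset_image_def)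
  ultimately have "finite (range (\<lambda>i::nat. ?S #> k [^] i))" by (rule finite_subset[rotated])
  then have "\<not> inj (\<lambda>i::nat. ?S #> k [^] i)" using finite_imageD by blast
  then obtain i j :: nat where ij: "i < j" "?S #> k [^] i = ?S #> k [^] j"
    unfolding inj_def by (metis linorder_neqE_nat)
  have "k [^] j \<in> ?S #> k [^] i" using rcos_self[OF _ S] kc ij(2) by simp
  then obtain s where s: "s \<in> ?S" "k [^] j = s \<otimes> k [^] i" by (auto simp: r_coset_def)
  have "k [^] (j - i) \<otimes> k [^] i = s \<otimes> k [^] i"
    using s(2) ij(1) kc by (simp add: nat_pow_mult)
  then have "k [^] (j - i) = s" using kc s(1) subgroup.mem_carrier[OF S] by simp
  then show thesis using that[of "j - i"] ij(1) s(1) by simp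
qed

text \<open>
  If \<open>k\<close> stabilises \<open>V\<close> then \<open>k U\<close> is equivalent to \<open>U\<close>, hence nested with it. A strict inclusion would
  remain strict for all powers of \<open>k\<close>, but some positive power stabilises \<open>U\<close>.
\<close>

lemma translate_stab_subset:
  assumes E: "nested_classes G E" "U \<in> E" and UV: "ai_sim G U V"
  shows "translate_stab G V \<subseteq> translate_stab G U"
proof
  fix k assume k: "k \<in> translate_stab G V"
  then have kc: "k \<in> carrier G" "k <# V = V" by (simp_all add: translate_stab_def)
  note D = nested_classesD[OF E]
  have "ai_sim G U (k <# U)"
    using UV ai_sim_sym[OF ai_sim_lcos[OF UV kc(1)]] kc(2) ai_sim_trans by simp
  then have nested: "U \<subseteq> k <# U \<or> k <# U \<subseteq> U" using D(4,5) kc by blast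
  have eq: "l <# U = U" if l: "l \<in> translate_stab G V" "l <# U \<subseteq> U" for l
  proof -
    obtain m :: nat where "m > 0" "l [^] m \<in> translate_stab G U"
      using nat_pow_mem_translate_stab[OF UV l(1)] .
    moreover have "l \<in> carrier G" using l(1) by (simp add: translate_stab_def)
    ultimately show ?thesis using lcos_eq_if_nat_pow[OF _ D(2) l(2)] by (simp add: translate_stab_def)
  qed
  have "k <# U = U"
  proof (cases "k <# U \<subseteq> U")
    case True
    then show ?thesis using eq k by blast
  next
    \<comment> \<open>If \<open>k\<close> enlarges \<open>U\<close>, its inverse shrinks \<open>U\<close>.\<close>
    case False
    then have "inv k <# U \<subseteq> inv k <# (k <# U)" using nested by (intro lcos_mono) blast
    then have "inv k <# U \<subseteq> U" using lcos_inv_cancel[OF kc(1) D(2)] by simp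
    moreover have "inv k \<in> translate_stab G V"
      using k subgroup.m_inv_closed[OF nontrivial_aiD(3)[OF ai_simD(2)[OF UV]]] by blast
    ultimately have "inv k <# U = U" using eq by blast
    then show ?thesis using lcos_inv_cancel(2)[OF kc(1) D(2)] by simp
  qed
  then show "k \<in> translate_stab G U" using kc by (simp add: translate_stab_def)
qed

lemma translate_stab_eq:
  assumes "nested_classes G E" "U \<in> E" "nested_classes G F" "V \<in> F" "ai_sim G U V"
  shows "translate_stab G U = translate_stab G V"
  using translate_stab_subset[OF assms(1,2,5)]
    translate_stab_subset[OF assms(3,4) ai_sim_sym[OF assms(5)]] by blast

section \<open>The signed difference of equivalent sets\<close>

lemma card_coset_image_Un:
  assumes S: "subgroup S G" and AB: "A \<subseteq> carrier G" "B \<subseteq> carrier G" "A \<inter> B = {}"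
    and B: "\<And>s x. \<lbrakk>s \<in> S; x \<in> carrier G\<rbrakk> \<Longrightarrow> s \<otimes> x \<in> B \<longleftrightarrow> x \<in> B"
    and fin: "H_finite G S A" "H_finite G S B"
  shows "card (coset_image G S (A \<union> B)) = card (coset_image G S A) + card (coset_image G S B)"
proof -
  have "S #> a \<noteq> S #> b" if "a \<in> A" "b \<in> B" for a b
  proof
    assume "S #> a = S #> b"
    then have "a \<in> S #> b" using rcos_self[OF _ S, of a] that AB by auto
    then obtain s where "s \<in> S" "a = s \<otimes> b" by (auto simp: r_coset_def)
    then have "a \<in> B" using B that AB by auto
    then show False using that AB by blast
  qed
  then have "coset_image G S A \<inter> coset_image G S B = {}" by (auto simp: coset_image_def)
  moreover have "coset_image G S (A \<union> B) = coset_image G S A \<union> coset_image G S B"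
    by (simp add: coset_image_def image_Un)
  ultimately show ?thesis
    using fin finite_coset_image_iff[OF S] AB by (simp add: card_Un_disjoint)
qed

text \<open>
  Heuristically \<open>d(U, V) = |S\U| - |S\V|\<close>, and the infinite terms cancel. The proof counts the pieces
  into which the three sets cut each other, all of which are finite unions of cosets except
  \<open>U \<inter> V \<inter> W\<close> and the complement of \<open>U \<union> V \<union> W\<close>.
\<close>

lemma signed_diff_trans:
  assumes UV: "ai_sim G U V" "translate_stab G U = translate_stab G V"
    and VW: "ai_sim G V W" "translate_stab G V = translate_stab G W"
  shows "signed_diff G U W = signed_diff G U V + signed_diff G V W"
proof -
  define S where "S = translate_stab G V"
  have SU: "translate_stab G U = S" and SW: "translate_stab G W = S"
    using UV VW by (simp_all add: S_def)
  have c: "U \<subseteq> carrier G" "V \<subseteq> carrier G" "W \<subseteq> carrier G"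
    using ai_simD(3,4) UV(1) VW(1) by blast+
  have S: "subgroup S G" unfolding S_def using c by (intro subgroup_translate_stab)
  have fin: "H_finite G S (sym_diff U V)" "H_finite G S (sym_diff V W)"
    using ai_simD(5)[OF UV(1)] ai_simD(5)[OF VW(1)] SU S_def by simp_all
  have inv: "s \<otimes> x \<in> U \<longleftrightarrow> x \<in> U" "s \<otimes> x \<in> V \<longleftrightarrow> x \<in> V" "s \<otimes> x \<in> W \<longleftrightarrow> x \<in> W"
    if "s \<in> S" "x \<in> carrier G" for s x
  proof -
    have "s \<in> translate_stab G U" "s \<in> translate_stab G V" "s \<in> translate_stab G W"
      using that(1) SU SW S_def by simp_all
    then show "s \<otimes> x \<in> U \<longleftrightarrow> x \<in> U" "s \<otimes> x \<in> V \<longleftrightarrow> x \<in> V" "s \<otimes> x \<in> W \<longleftrightarrow> x \<in> W"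
      using mem_translate_stab that(2) c by simp_all
  qed
  define \<mu> where "\<mu> A = int (card (coset_image G S A))" for A
  have split: "\<mu> C = \<mu> A + \<mu> B"
    if "C = A \<union> B" "A \<inter> B = {}" "H_finite G S A" "H_finite G S B" "A \<subseteq> carrier G" "B \<subseteq> carrier G"
      "\<And>s x. \<lbrakk>s \<in> S; x \<in> carrier G\<rbrakk> \<Longrightarrow> s \<otimes> x \<in> B \<longleftrightarrow> x \<in> B" for A B C
    unfolding \<mu>_def that(1) using card_coset_image_Un[OF S that(5,6,2,7,3,4)] by simp
  have f: "H_finite G S (U - V - W)" "H_finite G S (U \<inter> W - V)"
    "H_finite G S (V - U - W)" "H_finite G S (V \<inter> W - U)"
    by (rule H_finite_mono[OF fin(1)], blast)+
  have f': "H_finite G S (U \<inter> V - W)" "H_finite G S (W - U - V)"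
    by (rule H_finite_mono[OF fin(2)], blast)+
  have "\<mu> (U - V) = \<mu> (U - V - W) + \<mu> (U \<inter> W - V)"
    "\<mu> (V - U) = \<mu> (V - U - W) + \<mu> (V \<inter> W - U)"
    "\<mu> (V - W) = \<mu> (U \<inter> V - W) + \<mu> (V - U - W)"
    "\<mu> (W - V) = \<mu> (W - U - V) + \<mu> (U \<inter> W - V)"
    "\<mu> (U - W) = \<mu> (U - V - W) + \<mu> (U \<inter> V - W)"
    "\<mu> (W - U) = \<mu> (W - U - V) + \<mu> (V \<inter> W - U)"
    by (rule split, blast, blast, fact, fact, use c in blast, use c in blast, simp add: inv)+
  then show ?thesis
    unfolding signed_diff_def SU S_def[symmetric] \<mu>_def[symmetric] by simp
qed

lemma signed_diff_swap:
  assumes "translate_stab G U = translate_stab G V"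
  shows "signed_diff G V U = - signed_diff G U V"
  using assms by (simp add: signed_diff_def)

lemma signed_diff_star_compl:
  assumes "U \<subseteq> carrier G" "V \<subseteq> carrier G"
  shows "signed_diff G (star_compl G U) (star_compl G V) = - signed_diff G U V"
proof -
  have "star_compl G U - star_compl G V = V - U" "star_compl G V - star_compl G U = U - V"
    using assms by (auto simp: star_compl_def)
  then show ?thesis
    unfolding signed_diff_def translate_stab_star_compl[OF assms(1)] by simp
qed

text \<open>
  Translation by \<open>g\<close> maps cosets of the stabiliser \<open>S\<close> of \<open>U\<close> to cosets of \<open>g S g\<inverse>\<close>, the stabiliser of
  \<open>g U\<close>; counting with respect to the stabiliser of the first argument absorbs this change.
\<close>

lemma signed_diff_lcos:
  assumes g: "g \<in> carrier G" and UV: "U \<subseteq> carrier G" "V \<subseteq> carrier G"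
  shows "signed_diff G (g <# U) (g <# V) = signed_diff G U V"
proof -
  let ?S = "translate_stab G U"
  have S: "?S \<subseteq> carrier G" by (auto simp: translate_stab_def)
  have "card (coset_image G (translate_stab G (g <# U)) (g <# A)) = card (coset_image G ?S A)"
    if A: "A \<subseteq> carrier G" for A
  proof -
    have "coset_image G (translate_stab G (g <# U)) (g <# A)
        = (\<lambda>x. conj_subgroup G g ?S #> (g \<otimes> x)) ` A"
      unfolding translate_stab_lcos[OF g UV(1)] coset_image_def l_coset_def[of G g A] by auto
    also have "\<dots> = (\<lambda>x. g <# (?S #> x)) ` A"
      using A by (intro image_cong refl rcos_conj_subgroup[OF g S]) auto
    also have "\<dots> = (\<lambda>C. g <# C) ` coset_image G ?S A"
      by (simp add: coset_image_def image_image)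
    finally have eq: "coset_image G (translate_stab G (g <# U)) (g <# A)
        = (\<lambda>C. g <# C) ` coset_image G ?S A" .
    have "C \<subseteq> carrier G" if "C \<in> coset_image G ?S A" for C
      using that A r_coset_subset_G[OF S] by (auto simp: coset_image_def)
    then have "inj_on (\<lambda>C. g <# C) (coset_image G ?S A)"
      by (intro inj_on_inverseI[where g = "\<lambda>C. inv g <# C"]) (simp add: lcos_inv_cancel[OF g])
    then show ?thesis unfolding eq by (rule card_image)
  qed
  moreover have "U - V \<subseteq> carrier G" "V - U \<subseteq> carrier G" using UV by auto
  ultimately show ?thesis
    unfolding signed_diff_def using lcos_diff[OF g UV(1,2)] lcos_diff[OF g UV(2,1)] by metis
qed

lemma subset_iff_signed_diff:
  assumes UV: "ai_sim G U V" and nested: "U \<subseteq> V \<or> V \<subseteq> U"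
  shows "U \<subseteq> V \<longleftrightarrow> signed_diff G U V \<le> 0"
proof
  assume "U \<subseteq> V"
  then have UV0: "U - V = {}" by blast
  then show "signed_diff G U V \<le> 0" unfolding signed_diff_def UV0 by (simp add: coset_image_def[of G _ "{}"])
next
  let ?S = "translate_stab G U"
  note D = ai_simD[OF UV]
  assume le: "signed_diff G U V \<le> 0"
  show "U \<subseteq> V"
  proof (rule ccontr)
    assume not: "\<not> U \<subseteq> V"
    then have VU: "V - U = {}" using nested by blast
    have "H_finite G ?S (U - V)" by (rule H_finite_mono[OF D(5)]) blast
    then have "finite (coset_image G ?S (U - V))"
      using finite_coset_image_iff[OF nontrivial_aiD(3)[OF D(1)], of "U - V"] D(3) by blast
    moreover have "coset_image G ?S (U - V) \<noteq> {}" using not by (auto simp: coset_image_def)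
    ultimately have "card (coset_image G ?S (U - V)) > 0" by (simp add: card_gt_0_iff)
    then show False using le unfolding signed_diff_def VU by (simp add: coset_image_def[of G _ "{}"])
  qed
qed

end

section \<open>Choosing representatives on the same side of all reflections\<close>

definition signed_orbit :: "('a, 'b) monoid_scheme \<Rightarrow> 'a set \<Rightarrow> 'a set set" where
  "signed_orbit G U = {W. \<exists>g\<in>carrier G. W = g <#\<^bsub>G\<^esub> U \<or> W = star_compl G (g <#\<^bsub>G\<^esub> U)}"

text \<open>
  The situation reached after the representatives \<open>Z i\<close> have been corrected: the fourth condition
  says that \<open>Y i\<close> and \<open>Z i\<close> lie on the same side of every reflection of their class. The notion is
  symmetric in the two families (\<open>compatible_sym\<close>), although two of its conditions are stated in terms of \<open>Y\<close>.
\<close>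

definition compatible ::
    "('a, 'b) monoid_scheme \<Rightarrow> nat \<Rightarrow> (nat \<Rightarrow> 'a set) \<Rightarrow> (nat \<Rightarrow> 'a set) \<Rightarrow> bool" where
  "compatible G n Y Z \<longleftrightarrow>
     nested_classes G (E_set G n Y) \<and> nested_classes G (E_set G n Z) \<and>
     (\<forall>i\<in>{1..n}. ai_sim G (Y i) (Z i) \<and> \<not> invertible_ai G (Y i) \<and> \<not> invertible_ai G (Z i)) \<and>
     (\<forall>i\<in>{1..n}. \<forall>a\<in>carrier G. ai_sim G (a <#\<^bsub>G\<^esub> star_compl G (Y i)) (Y i) \<longrightarrow>
        (Y i \<subseteq> a <#\<^bsub>G\<^esub> star_compl G (Y i) \<longleftrightarrow> Z i \<subseteq> a <#\<^bsub>G\<^esub> star_compl G (Z i))) \<and>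
     (\<forall>i\<in>{1..n}. \<forall>j\<in>{1..n}. \<forall>g\<in>carrier G. i \<noteq> j \<longrightarrow>
        \<not> ai_sim G (g <#\<^bsub>G\<^esub> Y i) (Y j) \<and> \<not> ai_sim G (g <#\<^bsub>G\<^esub> Y i) (star_compl G (Y j)))"

text \<open>
  The graph of the bijection. As a relation it needs no choice of \<open>g\<close> and \<open>i\<close>, and exchanging \<open>Y\<close> and
  \<open>Z\<close> turns it into its converse, so a single uniqueness statement gives both that it is a function
  and that this function is injective.
\<close>

definition corresponds ::
    "('a, 'b) monoid_scheme \<Rightarrow> nat \<Rightarrow> (nat \<Rightarrow> 'a set) \<Rightarrow> (nat \<Rightarrow> 'a set) \<Rightarrow> 'a set \<Rightarrow> 'a set \<Rightarrow> bool"
  where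
  "corresponds G n Y Z U W \<longleftrightarrow>
     (\<exists>g\<in>carrier G. \<exists>i\<in>{1..n}. (U = g <#\<^bsub>G\<^esub> Y i \<and> W = g <#\<^bsub>G\<^esub> Z i) \<or>
        (U = star_compl G (g <#\<^bsub>G\<^esub> Y i) \<and> W = star_compl G (g <#\<^bsub>G\<^esub> Z i)))"

context group
begin

lemma E_set_eq_UN_signed_orbit: "E_set G n Y = (\<Union>i\<in>{1..n}. signed_orbit G (Y i))"
  unfolding E_set_def signed_orbit_def by blast

lemma self_mem_signed_orbit: "U \<subseteq> carrier G \<Longrightarrow> U \<in> signed_orbit G U"
  unfolding signed_orbit_def using lcos_mult_one one_closed by (intro CollectI bexI[of _ \<one>]) auto

lemma signed_orbit_closed:
  assumes U: "U \<subseteq> carrier G" and W: "W \<in> signed_orbit G U"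
  shows "W \<subseteq> carrier G" "star_compl G W \<in> signed_orbit G U"
    "h \<in> carrier G \<Longrightarrow> h <# W \<in> signed_orbit G U"
proof -
  obtain g where g: "g \<in> carrier G" and or: "W = g <# U \<or> W = star_compl G (g <# U)"
    using W unfolding signed_orbit_def by blast
  have gU: "g <# U \<subseteq> carrier G" using l_coset_subset_G[OF U g] .
  then show "W \<subseteq> carrier G" using or star_compl_subset by blast
  show "star_compl G W \<in> signed_orbit G U"
    using or g star_compl_star_compl[OF gU] unfolding signed_orbit_def by auto
  assume h: "h \<in> carrier G"
  have "h <# W = (h \<otimes> g) <# U \<or> h <# W = star_compl G ((h \<otimes> g) <# U)"
    using or lcos_star_compl[OF h gU] lcos_m_assoc[OF U h g] by auto
  then show "h <# W \<in> signed_orbit G U"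
    unfolding signed_orbit_def using m_closed[OF h g] by blast
qed

lemma signed_orbit_subset:
  assumes "U \<subseteq> carrier G" "W \<in> signed_orbit G U"
  shows "signed_orbit G W \<subseteq> signed_orbit G U"
  using signed_orbit_closed[OF assms(1)] assms(2) unfolding signed_orbit_def[of G W] by blast

lemma signed_orbit_sym:
  assumes U: "U \<subseteq> carrier G" and W: "W \<in> signed_orbit G U"
  shows "U \<in> signed_orbit G W"
proof -
  obtain g where g: "g \<in> carrier G" and or: "W = g <# U \<or> W = star_compl G (g <# U)"
    using W unfolding signed_orbit_def by blast
  have gU: "g <# U \<subseteq> carrier G" using l_coset_subset_G[OF U g] .
  have "U = inv g <# W \<or> U = star_compl G (inv g <# W)"
    using or lcos_inv_cancel(1)[OF g U] lcos_star_compl[OF inv_closed[OF g] gU]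
      star_compl_star_compl[OF U] by auto
  then show ?thesis unfolding signed_orbit_def using inv_closed[OF g] by blast
qed

lemma signed_orbit_eq:
  assumes "U \<subseteq> carrier G" "W \<in> signed_orbit G U"
  shows "signed_orbit G W = signed_orbit G U"
  using signed_orbit_subset[OF assms]
    signed_orbit_subset[OF signed_orbit_closed(1)[OF assms] signed_orbit_sym[OF assms]] by blast

lemma lcos_star_compl_eq_self_iff:
  assumes "a \<in> carrier G" "U \<subseteq> carrier G"
  shows "a <# star_compl G U = U \<longleftrightarrow> a <# U = star_compl G U"
  using lcos_star_compl[OF assms] star_compl_star_compl[OF assms(2)]
    star_compl_star_compl[OF l_coset_subset_G[OF assms(2,1)]] by metis

lemma invertible_ai_signed_orbit:
  assumes U: "U \<subseteq> carrier G" and W: "W \<in> signed_orbit G U" and inv: "invertible_ai G W"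
  shows "invertible_ai G U"
proof -
  obtain a where a: "a \<in> carrier G" "a <# W = star_compl G W"
    using inv unfolding invertible_ai_def by blast
  obtain g where g: "g \<in> carrier G" and or: "W = g <# U \<or> W = star_compl G (g <# U)"
    using W unfolding signed_orbit_def by blast
  have gU: "g <# U \<subseteq> carrier G" using l_coset_subset_G[OF U g] .
  have "a <# (g <# U) = star_compl G (g <# U)"
    using or a(2) lcos_star_compl_eq_self_iff[OF a(1) gU] star_compl_star_compl[OF gU] by auto
  then have "inv g <# (a <# (g <# U)) = star_compl G U"
    using lcos_inv_cancel(1)[OF g star_compl_subset, of U] unfolding lcos_star_compl[OF g U] by simp
  then have "(inv g \<otimes> a \<otimes> g) <# U = star_compl G U"
    using U a(1) g by (simp add: lcos_m_assoc m_assoc)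
  then show ?thesis unfolding invertible_ai_def using a(1) g by blast
qed

text \<open>
  On the line with coordinate \<open>d(-, Y)\<close>, the set \<open>Y\<close> is at \<open>0\<close>, \<open>W\<close> at \<open>x\<close>, \<open>a Y\<^sup>*\<close> at \<open>r\<close> and \<open>a W\<^sup>*\<close> at
  \<open>r - x\<close>. So \<open>Y \<subseteq> a Y\<^sup>*\<close> means \<open>0 \<le> r\<close>, and \<open>W \<subseteq> a W\<^sup>*\<close> means \<open>2 x \<le> r\<close>. If \<open>W\<close> minimises \<open>|x|\<close>,
  then \<open>|x| \<le> |r - x|\<close>, and the two conditions agree unless \<open>r = 0\<close> or \<open>2 x = r\<close>, that is, unless
  \<open>Y\<close> or \<open>W\<close> is invertible.
\<close>

lemma exists_nearest_translate:
  assumes E: "nested_classes G E" "Y \<in> E" and F: "nested_classes G F" "signed_orbit G Z \<subseteq> F"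
    and YZ: "ai_sim G Y Z" and ninv: "\<not> invertible_ai G Y" "\<not> invertible_ai G Z"
  obtains W where "W \<in> signed_orbit G Z" "ai_sim G Y W"
    "\<And>a. \<lbrakk>a \<in> carrier G; ai_sim G (a <# star_compl G Y) Y\<rbrakk> \<Longrightarrow>
       Y \<subseteq> a <# star_compl G Y \<longleftrightarrow> W \<subseteq> a <# star_compl G W"
proof -
  define P where "P V \<longleftrightarrow> V \<in> signed_orbit G Z \<and> ai_sim G Y V" for V
  define c where "c V = nat \<bar>signed_diff G V Y\<bar>" for V
  have Zc: "Z \<subseteq> carrier G" "Y \<subseteq> carrier G" using ai_simD(3,4)[OF YZ] by blast+
  have "P Z" using YZ self_mem_signed_orbit[OF Zc(1)] by (simp add: P_def)
  then obtain W where W: "P W" and least: "\<And>V. P V \<Longrightarrow> c W \<le> c V"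
    using ex_has_least_nat[of P Z c] by blast
  have WZ: "W \<in> signed_orbit G Z" and YW: "ai_sim G Y W" using W by (simp_all add: P_def)
  have Wc: "W \<subseteq> carrier G" using ai_simD(4)[OF YW] .
  have stab: "translate_stab G U = translate_stab G V"
    if "U \<in> E \<or> U \<in> F" "V \<in> E \<or> V \<in> F" "ai_sim G U V" for U V
    using that translate_stab_eq[OF E(1) _ E(1)] translate_stab_eq[OF E(1) _ F(1)]
      translate_stab_eq[OF F(1) _ E(1)] translate_stab_eq[OF F(1) _ F(1)] by blast
  show thesis
  proof (rule that[OF WZ YW])
    fix a assume a: "a \<in> carrier G" and aY: "ai_sim G (a <# star_compl G Y) Y"
    let ?Y' = "a <# star_compl G Y" and ?W' = "a <# star_compl G W"
    have W'Z: "?W' \<in> signed_orbit G Z"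
      using signed_orbit_closed[OF Zc(1)] WZ a by blast
    have Y'W': "ai_sim G ?Y' ?W'" using ai_sim_lcos[OF ai_sim_star_compl[OF YW] a] .
    have YY': "ai_sim G Y ?Y'" using ai_sim_sym[OF aY] .
    have YW': "ai_sim G Y ?W'" using ai_sim_trans[OF YY' Y'W'] .
    have WW': "ai_sim G W ?W'" using ai_sim_trans[OF ai_sim_sym[OF YW] YW'] .
    have Y'E: "?Y' \<in> E" using nested_classesD[OF E(1)] E(2) a by blast
    have mem: "W \<in> F" "?W' \<in> F" using WZ W'Z F(2) by blast+
    define r x where "r = signed_diff G ?Y' Y" and "x = signed_diff G W Y"
    have "signed_diff G ?W' Y = signed_diff G ?W' ?Y' + r"
      unfolding r_def using stab E(2) Y'E mem
      by (intro signed_diff_trans[OF ai_sim_sym[OF Y'W'] _ aY]) (simp_all add: Y'W' ai_sim_sym aY)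
    also have "signed_diff G ?W' ?Y' = - x"
      unfolding x_def using signed_diff_lcos[OF a star_compl_subset star_compl_subset]
        signed_diff_star_compl[OF Wc Zc(2)] by metis
    finally have W'Y: "signed_diff G ?W' Y = r - x" by simp
    have stabs: "translate_stab G W = translate_stab G Y" "translate_stab G Y = translate_stab G ?W'"
      "translate_stab G ?Y' = translate_stab G Y"
      using stab E(2) Y'E mem by (simp_all add: YW' ai_sim_sym[OF YW] aY)
    have "signed_diff G W ?W' = x + signed_diff G Y ?W'"
      unfolding x_def by (rule signed_diff_trans[OF ai_sim_sym[OF YW] stabs(1) YW' stabs(2)])
    also have "signed_diff G Y ?W' = x - r"
      using signed_diff_swap[OF stabs(2)[symmetric]] W'Y by simp
    finally have dW: "signed_diff G W ?W' = 2 * x - r" by simp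
    have dY: "signed_diff G Y ?Y' = - r"
      unfolding r_def by (rule signed_diff_swap[OF stabs(3)])
    \<comment> \<open>The reflected set \<open>a W\<^sup>*\<close> competes with \<open>W\<close> for being nearest to \<open>Y\<close>.\<close>
    have "c W \<le> c ?W'" using least W'Z YW' by (simp add: P_def)
    then have min: "\<bar>x\<bar> \<le> \<bar>r - x\<bar>" unfolding c_def W'Y x_def[symmetric] by simp
    have nest: "W \<subseteq> ?W' \<or> ?W' \<subseteq> W" "Y \<subseteq> ?Y' \<or> ?Y' \<subseteq> Y"
      using nested_classesD(5)[OF F(1) mem WW'] nested_classesD(5)[OF E Y'E YY'] by blast+
    have "Y \<noteq> ?Y'"
      using ninv(1) lcos_star_compl_eq_self_iff[OF a Zc(2)] a unfolding invertible_ai_def by metis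
    moreover have "W \<noteq> ?W'"
      using ninv(2) invertible_ai_signed_orbit[OF Zc(1) WZ] lcos_star_compl_eq_self_iff[OF a Wc] a
      unfolding invertible_ai_def by metis
    moreover have "signed_diff G ?W' W = r - 2 * x"
      using signed_diff_swap[OF trans[OF stabs(1,2)]] dW by simp
    ultimately have "r \<noteq> 0" "2 * x \<noteq> r"
      using subset_iff_signed_diff[OF YY' nest(2)] subset_iff_signed_diff[OF aY] nest
        subset_iff_signed_diff[OF WW' nest(1)] subset_iff_signed_diff[OF ai_sim_sym[OF WW']]
        dW dY r_def by auto
    then have "- r \<le> 0 \<longleftrightarrow> 2 * x - r \<le> 0" using min by linarith
    then show "Y \<subseteq> ?Y' \<longleftrightarrow> W \<subseteq> ?W'"
      using subset_iff_signed_diff[OF YY' nest(2)] subset_iff_signed_diff[OF WW' nest(1)] dW dY by simp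
  qed
qed

lemma compatibleD:
  assumes "compatible G n Y Z"
  shows "nested_classes G (E_set G n Y)" "nested_classes G (E_set G n Z)"
    "i \<in> {1..n} \<Longrightarrow> ai_sim G (Y i) (Z i)"
    "i \<in> {1..n} \<Longrightarrow> \<not> invertible_ai G (Y i)"
    "i \<in> {1..n} \<Longrightarrow> \<not> invertible_ai G (Z i)"
    "\<lbrakk>i \<in> {1..n}; a \<in> carrier G; ai_sim G (a <# star_compl G (Y i)) (Y i)\<rbrakk> \<Longrightarrow>
       Y i \<subseteq> a <# star_compl G (Y i) \<longleftrightarrow> Z i \<subseteq> a <# star_compl G (Z i)"
    "\<lbrakk>i \<in> {1..n}; j \<in> {1..n}; g \<in> carrier G; ai_sim G (g <# Y i) (Y j)\<rbrakk> \<Longrightarrow> i = j"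
    "\<lbrakk>i \<in> {1..n}; j \<in> {1..n}; g \<in> carrier G; ai_sim G (g <# Y i) (star_compl G (Y j))\<rbrakk> \<Longrightarrow> i = j"
  using assms unfolding compatible_def by blast+

lemma compatible_sym:
  assumes C: "compatible G n Y Z"
  shows "compatible G n Z Y"
proof -
  note D = compatibleD[OF C]
  have sim: "ai_sim G (g <# Y i) (g <# Z i)" "ai_sim G (g <# star_compl G (Y i)) (g <# star_compl G (Z i))"
    if "i \<in> {1..n}" "g \<in> carrier G" for g i
    using ai_sim_lcos[OF _ that(2)] ai_sim_star_compl[OF D(3)] D(3) that(1) by simp_all
  have "ai_sim G (a <# star_compl G (Y i)) (Y i)"
    if "i \<in> {1..n}" "a \<in> carrier G" "ai_sim G (a <# star_compl G (Z i)) (Z i)" for i a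
    using ai_sim_trans[OF ai_sim_trans[OF sim(2)[OF that(1,2)] that(3)]]
      ai_sim_sym[OF D(3)[OF that(1)]] .
  moreover have "ai_sim G (g <# Y i) (Y j)"
    if "i \<in> {1..n}" "j \<in> {1..n}" "g \<in> carrier G" "ai_sim G (g <# Z i) (Z j)" for i j g
    using ai_sim_trans[OF ai_sim_trans[OF sim(1)[OF that(1,3)] that(4)]]
      ai_sim_sym[OF D(3)[OF that(2)]] .
  moreover have "ai_sim G (g <# Y i) (star_compl G (Y j))"
    if "i \<in> {1..n}" "j \<in> {1..n}" "g \<in> carrier G" "ai_sim G (g <# Z i) (star_compl G (Z j))" for i j g
    using ai_sim_trans[OF ai_sim_trans[OF sim(1)[OF that(1,3)] that(4)]]
      ai_sim_sym[OF ai_sim_star_compl[OF D(3)[OF that(2)]]] .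
  ultimately show ?thesis
    unfolding compatible_def using D(1,2,4,5) D(6,7,8) ai_sim_sym[OF D(3)]
    by (intro conjI ballI impI notI) metis+
qed

section \<open>The correspondence preserves inclusion inside equivalence classes\<close>

lemma lcos_subset_iff:
  assumes g: "g \<in> carrier G" and AB: "A \<subseteq> carrier G" "B \<subseteq> carrier G"
  shows "g <# A \<subseteq> B \<longleftrightarrow> A \<subseteq> inv g <# B"
  using lcos_mono[of "g <# A" B "inv g"] lcos_mono[of A "inv g <# B" g]
    lcos_inv_cancel[OF g AB(1)] lcos_inv_cancel[OF g AB(2)] by auto

lemma inv_lcos_star_compl:
  assumes "g \<in> carrier G" "h \<in> carrier G" "U \<subseteq> carrier G"
  shows "inv g <# star_compl G (h <# U) = (inv g \<otimes> h) <# star_compl G U"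
  using assms lcos_star_compl[of h U] lcos_m_assoc[OF star_compl_subset, of "inv g" h U] by simp

lemma corresponds_swap: "corresponds G n Y Z U W \<longleftrightarrow> corresponds G n Z Y W U"
  unfolding corresponds_def by blast

lemma corresponds_mem:
  assumes "corresponds G n Y Z U W"
  shows "U \<in> E_set G n Y" "W \<in> E_set G n Z"
  using assms unfolding corresponds_def E_set_def by blast+

lemma exists_corresponds:
  assumes "U \<in> E_set G n Y"
  shows "\<exists>W. corresponds G n Y Z U W"
  using assms unfolding corresponds_def E_set_def by blast

lemma corresponds_ai_sim:
  assumes "compatible G n Y Z" "corresponds G n Y Z U W"
  shows "ai_sim G U W"
  using assms(2) ai_sim_lcos[OF compatibleD(3)[OF assms(1)]]
    ai_sim_star_compl[OF ai_sim_lcos[OF compatibleD(3)[OF assms(1)]]]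
  unfolding corresponds_def by blast

lemma corresponds_lcos:
  assumes C: "compatible G n Y Z" and UW: "corresponds G n Y Z U W" and h: "h \<in> carrier G"
  shows "corresponds G n Y Z (h <# U) (h <# W)"
proof -
  obtain g i where gi: "g \<in> carrier G" "i \<in> {1..n}"
    and or: "(U = g <# Y i \<and> W = g <# Z i) \<or> (U = star_compl G (g <# Y i) \<and> W = star_compl G (g <# Z i))"
    using UW unfolding corresponds_def by blast
  have c: "Y i \<subseteq> carrier G" "Z i \<subseteq> carrier G"
    using ai_simD(3,4)[OF compatibleD(3)[OF C gi(2)]] by blast+
  have "h <# (g <# V) = (h \<otimes> g) <# V"
    "h <# star_compl G (g <# V) = star_compl G ((h \<otimes> g) <# V)" if "V \<subseteq> carrier G" for V
    using that h gi(1) by (simp_all add: lcos_star_compl lcos_m_assoc l_coset_subset_G)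
  then show ?thesis
    using or c gi(2) m_closed[OF h gi(1)] unfolding corresponds_def by metis
qed

text \<open>
  Here no choice of representatives is involved: additivity and \<open>d(g Y\<^sub>i, g Z\<^sub>i) = d(h Y\<^sub>i, h Z\<^sub>i)\<close> give
  \<open>d(g Z\<^sub>i, h Z\<^sub>i) = d(g Y\<^sub>i, h Y\<^sub>i)\<close>, and the sign decides.
\<close>

lemma translates_mono:
  assumes C: "compatible G n Y Z" and i: "i \<in> {1..n}" and gh: "g \<in> carrier G" "h \<in> carrier G"
    and sim: "ai_sim G (g <# Y i) (h <# Y i)" and sub: "g <# Y i \<subseteq> h <# Y i"
  shows "g <# Z i \<subseteq> h <# Z i"
proof -
  note D = compatibleD[OF C]
  have c: "Y i \<subseteq> carrier G" "Z i \<subseteq> carrier G" using ai_simD(3,4)[OF D(3)[OF i]] by blast+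
  note YZ = ai_sim_lcos[OF D(3)[OF i]]
  have simZ: "ai_sim G (g <# Z i) (h <# Z i)"
    using ai_sim_trans[OF ai_sim_sym[OF YZ[OF gh(1)]] ai_sim_trans[OF sim YZ[OF gh(2)]]] .
  note EY = E_setI(1)[OF i gh(1), of Y] E_setI(1)[OF i gh(2), of Y]
  note EZ = E_setI(1)[OF i gh(1), of Z] E_setI(1)[OF i gh(2), of Z]
  note s1 = translate_stab_eq[OF D(1) EY(1) D(2) EZ(1) YZ[OF gh(1)]]
  have s: "translate_stab G (g <# Y i) = translate_stab G (h <# Y i)"
    "translate_stab G (h <# Y i) = translate_stab G (h <# Z i)"
    using translate_stab_eq[OF D(1) EY(1) D(1) EY(2) sim]
      translate_stab_eq[OF D(1) EY(2) D(2) EZ(2) YZ[OF gh(2)]] by simp_all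
  have sZ: "translate_stab G (g <# Z i) = translate_stab G (h <# Z i)"
    using translate_stab_eq[OF D(2) EZ(1) D(2) EZ(2) simZ] .
  have "signed_diff G (g <# Y i) (h <# Z i)
      = signed_diff G (g <# Y i) (h <# Y i) + signed_diff G (h <# Y i) (h <# Z i)"
    by (rule signed_diff_trans[OF sim s(1) YZ[OF gh(2)] s(2)])
  moreover have "signed_diff G (g <# Y i) (h <# Z i)
      = signed_diff G (g <# Y i) (g <# Z i) + signed_diff G (g <# Z i) (h <# Z i)"
    by (rule signed_diff_trans[OF YZ[OF gh(1)] s1 simZ sZ])
  ultimately have "signed_diff G (g <# Z i) (h <# Z i) = signed_diff G (g <# Y i) (h <# Y i)"
    using signed_diff_lcos[OF _ c] gh by simp
  moreover have "signed_diff G (g <# Y i) (h <# Y i) \<le> 0"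
    using subset_iff_signed_diff[OF sim] sub by blast
  moreover have "g <# Z i \<subseteq> h <# Z i \<or> h <# Z i \<subseteq> g <# Z i"
    using nested_classesD(5)[OF D(2) EZ simZ] .
  ultimately show ?thesis using subset_iff_signed_diff[OF simZ] by simp
qed

text \<open>
  Translating back by \<open>g\<close> reduces this to the reflection given by \<open>a = g\<inverse> h\<close>, that is, to the choice
  of \<open>Z i\<close>.
\<close>

lemma translate_subset_star_compl_iff:
  assumes C: "compatible G n Y Z" and i: "i \<in> {1..n}" and gh: "g \<in> carrier G" "h \<in> carrier G"
    and sim: "ai_sim G (g <# Y i) (star_compl G (h <# Y i))"
  shows "g <# Y i \<subseteq> star_compl G (h <# Y i) \<longleftrightarrow> g <# Z i \<subseteq> star_compl G (h <# Z i)"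
proof -
  note D = compatibleD[OF C]
  have c: "Y i \<subseteq> carrier G" "Z i \<subseteq> carrier G" using ai_simD(3,4)[OF D(3)[OF i]] by blast+
  have a: "inv g \<otimes> h \<in> carrier G" using gh by simp
  have shift: "g <# V \<subseteq> star_compl G (h <# V) \<longleftrightarrow> V \<subseteq> (inv g \<otimes> h) <# star_compl G V"
    if "V \<subseteq> carrier G" for V
    using lcos_subset_iff[OF gh(1) that star_compl_subset] inv_lcos_star_compl[OF gh that] by simp
  have "ai_sim G (inv g <# (g <# Y i)) (inv g <# star_compl G (h <# Y i))"
    using ai_sim_lcos[OF sim] gh(1) by simp
  then have "ai_sim G ((inv g \<otimes> h) <# star_compl G (Y i)) (Y i)"
    using lcos_inv_cancel(1)[OF gh(1) c(1)] inv_lcos_star_compl[OF gh c(1)] ai_sim_sym by simp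
  then show ?thesis using D(6)[OF i a] shift c by simp
qed

text \<open>
  As \<open>Y i\<close> is not invertible, the given inclusion is strict, so the opposite inclusion fails for
  \<open>Y i\<close>, hence by the previous lemma for \<open>Z i\<close>; nestedness does the rest.
\<close>

lemma star_compl_translate_mono:
  assumes C: "compatible G n Y Z" and i: "i \<in> {1..n}" and gh: "g \<in> carrier G" "h \<in> carrier G"
    and sim: "ai_sim G (star_compl G (g <# Y i)) (h <# Y i)" and sub: "star_compl G (g <# Y i) \<subseteq> h <# Y i"
  shows "star_compl G (g <# Z i) \<subseteq> h <# Z i"
proof -
  note D = compatibleD[OF C]
  note YZ = ai_sim_lcos[OF D(3)[OF i]]
  have c: "Y i \<subseteq> carrier G" "Z i \<subseteq> carrier G" using ai_simD(3,4)[OF D(3)[OF i]] by blast+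
  have "h <# Y i \<noteq> star_compl G (g <# Y i)"
  proof
    assume eq: "h <# Y i = star_compl G (g <# Y i)"
    then have "(inv h \<otimes> g) <# star_compl G (Y i) = Y i"
      using lcos_inv_cancel(1)[OF gh(2) c(1)] inv_lcos_star_compl[OF gh(2,1) c(1)] by simp
    then have "invertible_ai G (Y i)"
      using lcos_star_compl_eq_self_iff[OF _ c(1), of "inv h \<otimes> g"] gh
      unfolding invertible_ai_def by auto
    then show False using D(4)[OF i] by blast
  qed
  then have "\<not> h <# Y i \<subseteq> star_compl G (g <# Y i)" using sub by blast
  then have "\<not> h <# Z i \<subseteq> star_compl G (g <# Z i)"
    using translate_subset_star_compl_iff[OF C i gh(2,1) ai_sim_sym[OF sim]] by simp
  moreover have "ai_sim G (h <# Z i) (star_compl G (g <# Z i))"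
    using ai_sim_trans[OF ai_sim_sym[OF YZ[OF gh(2)]] ai_sim_trans[OF ai_sim_sym[OF sim]
      ai_sim_star_compl[OF YZ[OF gh(1)]]]] .
  ultimately show ?thesis
    using nested_classesD(5)[OF D(2) E_setI(1)[OF i gh(2)] E_setI(2)[OF i gh(1)]] by blast
qed

text \<open>
  Since distinct orbits are not parallel, \<open>U\<close> and \<open>V\<close> come from the same index. The
  four choices of complements are covered by the three preceding lemmas.
\<close>

lemma corresponds_mono:
  assumes C: "compatible G n Y Z" and U: "corresponds G n Y Z U U'" and V: "corresponds G n Y Z V V'"
    and sim: "ai_sim G U V" and sub: "U \<subseteq> V"
  shows "U' \<subseteq> V'"
proof -
  note D = compatibleD[OF C]
  obtain g i where gi: "g \<in> carrier G" "i \<in> {1..n}"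
    and orU: "(U = g <# Y i \<and> U' = g <# Z i) \<or> (U = star_compl G (g <# Y i) \<and> U' = star_compl G (g <# Z i))"
    using U unfolding corresponds_def by blast
  obtain h j where hj: "h \<in> carrier G" "j \<in> {1..n}"
    and orV: "(V = h <# Y j \<and> V' = h <# Z j) \<or> (V = star_compl G (h <# Y j) \<and> V' = star_compl G (h <# Z j))"
    using V unfolding corresponds_def by blast
  have ci: "Y i \<subseteq> carrier G" "Z i \<subseteq> carrier G" using ai_simD(3,4)[OF D(3)[OF gi(2)]] by blast+
  have cj: "Y j \<subseteq> carrier G" using ai_simD(3)[OF D(3)[OF hj(2)]] .
  have gY: "g <# Y i \<subseteq> carrier G" "g <# Z i \<subseteq> carrier G" "h <# Y i \<subseteq> carrier G" "h <# Y j \<subseteq> carrier G"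
    "h <# Z i \<subseteq> carrier G"
    using l_coset_subset_G gi(1) hj(1) ci cj by simp_all
  have sim': "ai_sim G (star_compl G U) (star_compl G V)" using ai_sim_star_compl[OF sim] .
  have "ai_sim G (g <# Y i) (h <# Y j) \<or> ai_sim G (g <# Y i) (star_compl G (h <# Y j))"
    using orU orV sim sim' gY by (auto simp: star_compl_star_compl)
  then have "ai_sim G (inv h <# (g <# Y i)) (inv h <# (h <# Y j)) \<or>
      ai_sim G (inv h <# (g <# Y i)) (inv h <# star_compl G (h <# Y j))"
    using ai_sim_lcos[OF _ inv_closed[OF hj(1)]] by metis
  then have "ai_sim G ((inv h \<otimes> g) <# Y i) (Y j) \<or>
      ai_sim G ((inv h \<otimes> g) <# Y i) (star_compl G (Y j))"
    using lcos_inv_cancel(1)[OF hj(1) cj] inv_lcos_star_compl[OF hj(1,1) cj]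
      lcos_m_assoc[OF ci(1), of "inv h" g] gi(1) hj(1) by (simp add: lcos_mult_one star_compl_subset)
  then have ij: "i = j" using D(7,8)[OF gi(2) hj(2), of "inv h \<otimes> g"] gi(1) hj(1) by auto
  note i = gi(2)
  have anti: "\<And>A B. \<lbrakk>A \<subseteq> carrier G; B \<subseteq> carrier G\<rbrakk> \<Longrightarrow> star_compl G A \<subseteq> star_compl G B \<longleftrightarrow> B \<subseteq> A"
    by (auto simp: star_compl_def)
  from orU orV show ?thesis unfolding ij[symmetric]
  proof (elim disjE conjE)
    assume "U = g <# Y i" "U' = g <# Z i" "V = h <# Y i" "V' = h <# Z i"
    then show ?thesis using translates_mono[OF C i gi(1) hj(1)] sim sub by simp
  next
    assume "U = g <# Y i" "U' = g <# Z i" "V = star_compl G (h <# Y i)" "V' = star_compl G (h <# Z i)"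
    then show ?thesis using translate_subset_star_compl_iff[OF C i gi(1) hj(1)] sim sub by simp
  next
    assume "U = star_compl G (g <# Y i)" "U' = star_compl G (g <# Z i)" "V = h <# Y i" "V' = h <# Z i"
    then show ?thesis using star_compl_translate_mono[OF C i gi(1) hj(1)] sim sub by simp
  next
    assume *: "U = star_compl G (g <# Y i)" "U' = star_compl G (g <# Z i)"
      "V = star_compl G (h <# Y i)" "V' = star_compl G (h <# Z i)"
    then have "h <# Y i \<subseteq> g <# Y i" "ai_sim G (h <# Y i) (g <# Y i)"
      using sub sim' anti[OF gY(1,3)] gY ai_sim_sym by (simp_all add: star_compl_star_compl)
    then have "h <# Z i \<subseteq> g <# Z i" using translates_mono[OF C i hj(1) gi(1)] by blast
    then show ?thesis using * anti gY by simp
  qed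
qed

text \<open>
  Monotonicity for the pairs \<open>(U, W)\<close> and \<open>(U, W')\<close>, in both orders. In particular \<open>g Y\<^sub>i = Y\<^sub>i\<close>
  forces \<open>g Z\<^sub>i = Z\<^sub>i\<close>.
\<close>

lemma corresponds_functional:
  assumes C: "compatible G n Y Z" and "corresponds G n Y Z U W" "corresponds G n Y Z U W'"
  shows "W = W'"
proof -
  have "ai_sim G U U" using ai_sim_refl ai_simD(1) corresponds_ai_sim[OF assms(1,2)] by blast
  then show ?thesis
    using corresponds_mono[OF C assms(2,3)] corresponds_mono[OF C assms(3,2)] by blast
qed

section \<open>The order between inequivalent sets\<close>

text \<open>
  Replacing \<open>U\<close> by \<open>U'\<close> changes the corner by a set that is small for \<open>U\<close>, replacing \<open>V\<close> by \<open>V'\<close> changes it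
  by a set that is small for \<open>V\<close>. The two replacements have to be made one after the other, with
  \<open>H_finite_corner_sym\<close> in between to pass from the one notion of smallness to the other.
\<close>

lemma small_corner_transfer:
  assumes UU': "ai_sim G U U'" and VV': "ai_sim G V V'"
    and fin: "H_finite G (translate_stab G U) (U \<inter> star_compl G V)"
  shows "H_finite G (translate_stab G U') (U' \<inter> star_compl G V')"
    "H_finite G (translate_stab G V') (U' \<inter> star_compl G V')"
proof -
  note DU = ai_simD[OF UU'] and DV = ai_simD[OF VV']
  note nV = nontrivial_ai_star_compl[OF DV(1)] and nV' = nontrivial_ai_star_compl[OF DV(2)]
  have sV: "translate_stab G (star_compl G V) = translate_stab G V"
    "translate_stab G (star_compl G V') = translate_stab G V'"
    using translate_stab_star_compl DV(3,4) by simp_all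
  have "H_finite G (translate_stab G U) (U' \<inter> star_compl G V)"
    by (rule H_finite_mono[OF H_finite_Un[OF fin DU(5)]]) (auto simp: star_compl_def)
  then have "H_finite G (translate_stab G U') (U' \<inter> star_compl G V)" using DU(6) by simp
  then have f: "H_finite G (translate_stab G V) (U' \<inter> star_compl G V)"
    using H_finite_corner_sym[OF DU(2)[unfolded nontrivial_ai_def] nontrivial_aiD(1)[OF nV]] sV
    by simp
  have "H_finite G (translate_stab G V) (U' \<inter> star_compl G V')"
    by (rule H_finite_mono[OF H_finite_Un[OF f DV(5)]]) (auto simp: star_compl_def)
  then show f': "H_finite G (translate_stab G V') (U' \<inter> star_compl G V')" using DV(6) by simp
  show "H_finite G (translate_stab G U') (U' \<inter> star_compl G V')"
    using H_finite_corner_sym[OF nV'[unfolded nontrivial_ai_def] nontrivial_aiD(1)[OF DU(2)]] sV f'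
    by (simp add: Int_commute)
qed

text \<open>
  For equivalent \<open>U\<close>, \<open>V\<close> two corners are small, so \<open>U \<le> V\<close> amounts to inclusion, which is the
  hypothesis on \<open>U'\<close> and \<open>V'\<close>. Otherwise \<open>U' \<inter> V'\<^sup>*\<close> is small by \<open>small_corner_transfer\<close>, and a
  second small corner would make \<open>U'\<close> or \<open>V'\<^sup>*\<close> small, or \<open>U'\<close> equivalent to \<open>V'\<close>.
\<close>

lemma E_le_transfer:
  assumes UU': "ai_sim G U U'" and VV': "ai_sim G V V'"
    and mono: "\<lbrakk>ai_sim G U V; U \<subseteq> V\<rbrakk> \<Longrightarrow> U' \<subseteq> V'"
    and le: "E_le G U V"
  shows "E_le G U' V'"
proof -
  note DU = ai_simD[OF UU'] and DV = ai_simD[OF VV']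
  note nU' = nontrivial_aiD[OF DU(2)] and nV' = nontrivial_aiD[OF DV(2)]
  note small = small_corner_iff[OF DU(1) DV(1)] and small' = small_corner_iff[OF DU(2) DV(2)]
  let ?S = "translate_stab G U'"
  have finUV: "H_finite G (translate_stab G U) (U \<inter> star_compl G V)"
    using le small[of "U \<inter> star_compl G V"] unfolding E_le_def by (auto simp: H_finite_empty)
  note fin = small_corner_transfer[OF UU' VV' finUV]
  show ?thesis
  proof (cases "ai_sim G U V")
    case True
    have "star_compl G U \<inter> V \<subseteq> sym_diff U V" by (auto simp: star_compl_def)
    then have "H_finite G (translate_stab G U) (star_compl G U \<inter> V)"
      by (rule H_finite_mono[OF ai_simD(5)[OF True]])
    then have "small_corner G U V (star_compl G U \<inter> V)" using small by (simp add: corners_def)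
    then have "U \<inter> star_compl G V = {} \<or> star_compl G U \<inter> V = U \<inter> star_compl G V"
      using le unfolding E_le_def by metis
    then have "U \<subseteq> V" using DU(3) by (auto simp: star_compl_def)
    then have "U' \<inter> star_compl G V' = {}" using mono[OF True] by (auto simp: star_compl_def)
    then show ?thesis unfolding E_le_def by blast
  next
    case False
    have only: "C = U' \<inter> star_compl G V'" if C: "small_corner G U' V' C" for C
    proof -
      have Cfin: "H_finite G ?S C"
        and "C = U' \<inter> V' \<or> C = star_compl G U' \<inter> V' \<or> C = U' \<inter> star_compl G V' \<or>
          C = star_compl G U' \<inter> star_compl G V'"
        using C small' by (auto simp: corners_def)
      then consider "C = U' \<inter> V'" | "C = star_compl G U' \<inter> V'" | "C = U' \<inter> star_compl G V'"
        | "C = star_compl G U' \<inter> star_compl G V'" by blast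
      then show ?thesis
      proof cases
        case 1
        have "U' \<subseteq> C \<union> (U' \<inter> star_compl G V')" using nU'(2) by (auto simp: 1 star_compl_def)
        then have "H_finite G ?S U'" by (rule H_finite_mono[OF H_finite_Un[OF Cfin fin(1)]])
        then show ?thesis using nU'(4) by blast
      next
        case 2
        have "sym_diff U' V' \<subseteq> C \<union> (U' \<inter> star_compl G V')"
          using nU'(2) nV'(2) by (auto simp: 2 star_compl_def)
        then have "H_finite G ?S (sym_diff U' V')"
          by (rule H_finite_mono[OF H_finite_Un[OF Cfin fin(1)]])
        then have "ai_sim G U' V'" using DU(2) DV(2) by (simp add: ai_sim_def)
        then have "ai_sim G U V" using ai_sim_trans[OF ai_sim_trans[OF UU'] ai_sim_sym[OF VV']] by blast
        then show ?thesis using False by blast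
      next
        case 3
        then show ?thesis .
      next
        case 4
        have sU: "ai_sim G (star_compl G U') (star_compl G U')"
          using ai_sim_refl[OF nontrivial_ai_star_compl[OF DU(2)]] .
        have "H_finite G (translate_stab G (star_compl G U')) (star_compl G U' \<inter> star_compl G V')"
          using Cfin 4 translate_stab_star_compl[OF nU'(2)] by simp
        then have "H_finite G (translate_stab G V') (star_compl G U' \<inter> star_compl G V')"
          by (rule small_corner_transfer(2)[OF sU ai_sim_refl[OF DV(2)]])
        note un = H_finite_Un[OF this fin(2)]
        have "star_compl G V' \<subseteq> (star_compl G U' \<inter> star_compl G V') \<union> (U' \<inter> star_compl G V')"
          by (auto simp: star_compl_def)
        then have "H_finite G (translate_stab G V') (star_compl G V')" by (rule H_finite_mono[OF un])
        then show ?thesis using nV'(5) by blast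
      qed
    qed
    have corner: "small_corner G U' V' (U' \<inter> star_compl G V')"
      using small' fin(1) by (simp add: corners_def)
    show ?thesis unfolding E_le_def
    proof (intro disjI2 allI iffI)
      fix C
      show "C = U' \<inter> star_compl G V'" if "small_corner G U' V' C" using only[OF that] .
      show "small_corner G U' V' C" if "C = U' \<inter> star_compl G V'" unfolding that by (rule corner)
    qed
  qed
qed

section \<open>The bijection\<close>

lemma equivariant_bijection_if_compatible:
  assumes C: "compatible G n Y Z"
  shows "\<exists>\<phi>. bij_betw \<phi> (E_set G n Y) (E_set G n Z) \<and>
             G_equivariant_on G (E_set G n Y) \<phi> \<and>
             (\<forall>U\<in>E_set G n Y. \<forall>V\<in>E_set G n Y. E_le G U V \<longrightarrow> E_le G (\<phi> U) (\<phi> V)) \<and>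
             (\<forall>U\<in>E_set G n Y. ai_sim G (\<phi> U) U)"
proof -
  define \<phi> where "\<phi> U = (SOME W. corresponds G n Y Z U W)" for U
  have \<phi>: "corresponds G n Y Z U (\<phi> U)" if "U \<in> E_set G n Y" for U
    unfolding \<phi>_def using exists_corresponds[OF that] by (rule someI_ex)
  have \<phi>_eq: "\<phi> U = W" if "corresponds G n Y Z U W" for U W
    using corresponds_functional[OF C \<phi>[OF corresponds_mem(1)[OF that]] that] .
  have inj: "U = V" if "U \<in> E_set G n Y" "V \<in> E_set G n Y" "\<phi> U = \<phi> V" for U V
  proof -
    have "corresponds G n Z Y (\<phi> U) U" "corresponds G n Z Y (\<phi> U) V"
      using \<phi>[OF that(1)] \<phi>[OF that(2)] that(3) corresponds_swap by metis+
    then show ?thesis using corresponds_functional[OF compatible_sym[OF C]] by blast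
  qed
  have surj: "\<exists>U\<in>E_set G n Y. \<phi> U = W" if W: "W \<in> E_set G n Z" for W
  proof -
    obtain U where "corresponds G n Z Y W U" using exists_corresponds[OF W] by blast
    then have "corresponds G n Y Z U W" using corresponds_swap by metis
    from \<phi>_eq[OF this] corresponds_mem(1)[OF this] show ?thesis by blast
  qed
  have "bij_betw \<phi> (E_set G n Y) (E_set G n Z)"
    using inj surj corresponds_mem(2)[OF \<phi>] by (intro bij_betwI') metis+
  moreover have "G_equivariant_on G (E_set G n Y) \<phi>"
    unfolding G_equivariant_on_def using \<phi>_eq[OF corresponds_lcos[OF C \<phi>]] by (intro ballI)
  moreover have "E_le G (\<phi> U) (\<phi> V)"
    if "U \<in> E_set G n Y" "V \<in> E_set G n Y" "E_le G U V" for U V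
    using E_le_transfer[OF corresponds_ai_sim[OF C \<phi>[OF that(1)]] corresponds_ai_sim[OF C \<phi>[OF that(2)]]
      corresponds_mono[OF C \<phi>[OF that(1)] \<phi>[OF that(2)]] that(3)] .
  moreover have "ai_sim G (\<phi> U) U" if "U \<in> E_set G n Y" for U
    using ai_sim_sym[OF corresponds_ai_sim[OF C \<phi>[OF that]]] .
  ultimately show ?thesis by (intro exI[of _ \<phi>] conjI ballI impI)
qed

lemma ai_equiv_if_ai_sim:
  assumes "ai_sim G U V"
  shows "ai_equiv G U V"
  unfolding ai_equiv_def ai_equiv_over_def
  using ai_simD(1,2,5)[OF assms] nontrivial_aiD(1) by blast

lemma exists_compatible:
  assumes good: "good_position G n Y" "good_position G n Z"
    and YZ: "\<And>i. i \<in> {1..n} \<Longrightarrow> ai_sim G (Y i) (Z i)"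
    and ninv: "\<And>i. i \<in> {1..n} \<Longrightarrow> \<not> invertible_ai G (Y i)"
      "\<And>i. i \<in> {1..n} \<Longrightarrow> \<not> invertible_ai G (Z i)"
    and npar: "\<And>i j g. \<lbrakk>i \<in> {1..n}; j \<in> {1..n}; i \<noteq> j; g \<in> carrier G\<rbrakk> \<Longrightarrow>
        \<not> ai_sim G (g <# Y i) (Y j) \<and> \<not> ai_sim G (g <# Y i) (star_compl G (Y j))"
  obtains Z' where "compatible G n Y Z'" "E_set G n Z' = E_set G n Z"
proof -
  have EY: "nested_classes G (E_set G n Y)" and EZ: "nested_classes G (E_set G n Z)"
    using nested_classes_E_set[OF good(1)] nested_classes_E_set[OF good(2)] ai_simD(1,2)[OF YZ] by blast+
  have c: "Y i \<subseteq> carrier G" "Z i \<subseteq> carrier G" if "i \<in> {1..n}" for i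
    using ai_simD(3,4)[OF YZ[OF that]] by blast+
  have "\<exists>W. W \<in> signed_orbit G (Z i) \<and> ai_sim G (Y i) W \<and>
      (\<forall>a\<in>carrier G. ai_sim G (a <# star_compl G (Y i)) (Y i) \<longrightarrow>
        (Y i \<subseteq> a <# star_compl G (Y i) \<longleftrightarrow> W \<subseteq> a <# star_compl G W))"
    if i: "i \<in> {1..n}" for i
  proof -
    have "Y i \<in> E_set G n Y" "signed_orbit G (Z i) \<subseteq> E_set G n Z"
      unfolding E_set_eq_UN_signed_orbit using i self_mem_signed_orbit[OF c(1)[OF i]] by blast+
    from exists_nearest_translate[OF EY this(1) EZ this(2) YZ[OF i] ninv(1)[OF i] ninv(2)[OF i]]
    show ?thesis by metis
  qed
  then obtain Z' where Z': "\<And>i. i \<in> {1..n} \<Longrightarrow> Z' i \<in> signed_orbit G (Z i)"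
    "\<And>i. i \<in> {1..n} \<Longrightarrow> ai_sim G (Y i) (Z' i)"
    "\<And>i a. \<lbrakk>i \<in> {1..n}; a \<in> carrier G; ai_sim G (a <# star_compl G (Y i)) (Y i)\<rbrakk> \<Longrightarrow>
        Y i \<subseteq> a <# star_compl G (Y i) \<longleftrightarrow> Z' i \<subseteq> a <# star_compl G (Z' i)"
    by metis
  have E: "E_set G n Z' = E_set G n Z"
    unfolding E_set_eq_UN_signed_orbit using signed_orbit_eq[OF c(2) Z'(1)] by (intro SUP_cong refl)
  have "\<not> invertible_ai G (Z' i)" if "i \<in> {1..n}" for i
    using invertible_ai_signed_orbit[OF c(2)[OF that] Z'(1)[OF that]] ninv(2)[OF that] by blast
  then have "compatible G n Y Z'"
    unfolding compatible_def E using EY EZ Z'(2,3) ninv(1) npar by simp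
  then show thesis using E by (rule that)
qed

lemma ai_equiv_over_if_ai_sim:
  assumes X: "nontrivial_ai_over G H X" and Y: "nontrivial_ai_over G K Y"
    and sim: "ai_sim G X Y"
  shows "ai_equiv_over G H X K Y"
  using X Y ai_simD(5)[OF sim] nontrivial_ai_over_translate_stab(2)[OF X]
  by (simp add: ai_equiv_over_def nontrivial_ai_over_iff)

lemma nontrivial_ai_over_star_compl:
  assumes "nontrivial_ai_over G H X"
  shows "nontrivial_ai_over G H (star_compl G X)"
proof -
  have "X \<subseteq> carrier G" using assms unfolding nontrivial_ai_over_iff ai_over_iff by blast
  then show ?thesis
    using assms ai_over_star_compl unfolding nontrivial_ai_over_iff by (simp add: star_compl_star_compl)
qed

end

theorem lemma2p12:
  fixes G :: "('a, 'b) monoid_scheme"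
    and n :: nat
    and H K L X Y Z :: "nat \<Rightarrow> 'a set"
  assumes "group G"
    and "fin_gen G (carrier G)"
    and "\<And>i. i \<in> {1..n} \<Longrightarrow> subgroup (H i) G"
    and "\<And>i. i \<in> {1..n} \<Longrightarrow> fin_gen G (H i)"
    and "\<And>i. i \<in> {1..n} \<Longrightarrow> nontrivial_ai_over G (H i) (X i)"
    and "\<And>i j. i \<in> {1..n} \<Longrightarrow> j \<in> {1..n} \<Longrightarrow> i \<noteq> j \<Longrightarrow>
           \<not> parallel_orbits G (H i) (X i) (H j) (X j)"
    and "\<And>i. i \<in> {1..n} \<Longrightarrow> ai_over G (K i) (Y i)"
    and "\<And>i. i \<in> {1..n} \<Longrightarrow> ai_over G (L i) (Z i)"
    and "\<And>i. i \<in> {1..n} \<Longrightarrow> ai_equiv_over G (H i) (X i) (K i) (Y i)"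
    and "\<And>i. i \<in> {1..n} \<Longrightarrow> ai_equiv_over G (H i) (X i) (L i) (Z i)"
    and "good_position G n Y"
    and "good_position G n Z"
    and "\<And>i. i \<in> {1..n} \<Longrightarrow> \<not> invertible_ai G (Y i)"
    and "\<And>i. i \<in> {1..n} \<Longrightarrow> \<not> invertible_ai G (Z i)"
  shows "\<exists>\<phi>. bij_betw \<phi> (E_set G n Y) (E_set G n Z) \<and>
             G_equivariant_on G (E_set G n Y) \<phi> \<and>
             (\<forall>U\<in>E_set G n Y. \<forall>V\<in>E_set G n Y. E_le G U V \<longrightarrow> E_le G (\<phi> U) (\<phi> V)) \<and>
             (\<forall>U\<in>E_set G n Y. ai_equiv G (\<phi> U) U)"
proof -
  interpret group G by fact
  have XY: "ai_sim G (X i) (Y i)" and XZ: "ai_sim G (X i) (Z i)" if "i \<in> {1..n}" for i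
    using ai_sim_if_equiv_over assms(5,9,10) that by blast+
  have YZ: "ai_sim G (Y i) (Z i)" if "i \<in> {1..n}" for i
    using ai_sim_trans[OF ai_sim_sym[OF XY] XZ] that by blast
  have "\<not> ai_sim G (g <#\<^bsub>G\<^esub> Y i) (Y j) \<and> \<not> ai_sim G (g <#\<^bsub>G\<^esub> Y i) (star_compl G (Y j))"
    if ij: "i \<in> {1..n}" "j \<in> {1..n}" "i \<noteq> j" and g: "g \<in> carrier G" for i j g
  proof -
    note gX = nontrivial_ai_over_lcos[OF assms(5)[OF ij(1)] g]
    note gXY = ai_sim_lcos[OF XY[OF ij(1)] g]
    have "\<not> ai_sim G (g <#\<^bsub>G\<^esub> X i) (X j)" "\<not> ai_sim G (g <#\<^bsub>G\<^esub> X i) (star_compl G (X j))"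
      using assms(6)[OF ij] g ai_equiv_over_if_ai_sim[OF gX assms(5)[OF ij(2)]]
        ai_equiv_over_if_ai_sim[OF gX nontrivial_ai_over_star_compl[OF assms(5)[OF ij(2)]]]
      unfolding parallel_orbits_def by blast+
    then show ?thesis
      using ai_sim_trans[OF ai_sim_trans[OF gXY] ai_sim_sym[OF XY[OF ij(2)]]]
        ai_sim_trans[OF ai_sim_trans[OF gXY] ai_sim_sym[OF ai_sim_star_compl[OF XY[OF ij(2)]]]] by blast
  qed
  then obtain Z' where Z': "compatible G n Y Z'" "E_set G n Z' = E_set G n Z"
    using exists_compatible[OF assms(11,12) YZ assms(13,14)] by blast
  obtain \<phi> where "bij_betw \<phi> (E_set G n Y) (E_set G n Z)" "G_equivariant_on G (E_set G n Y) \<phi>"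
    "\<forall>U\<in>E_set G n Y. \<forall>V\<in>E_set G n Y. E_le G U V \<longrightarrow> E_le G (\<phi> U) (\<phi> V)"
    "\<forall>U\<in>E_set G n Y. ai_sim G (\<phi> U) U"
    using equivariant_bijection_if_compatible[OF Z'(1)] unfolding Z'(2) by blast
  then show ?thesis using ai_equiv_if_ai_sim by blast
qed

end
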